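(* Let $Y$ and $X$ be the spatio-temporal processes defined in the context, and suppose that assumptions (A1) and (A2) stated there hold. Then, for all integers $h\ge 1$, $Y(s,h\,\delta t)$ and $X(s,h\,\delta t)$ are continuous in $s\in S$ in the mean square sense.
   Context: $S\subset\mathbb{R}^2$ is a compact set containing a rectangle of positive area; $\|\cdot\|$ is the Euclidean norm. For $v=(v_1,v_2)\in\mathbb{R}^2$ write $v^2:=(v_1^2,v_2^2)$. For $s\in S$ define $M_s:=\exp\left(\max\{\|s^2-u^2\|^2: u\in S\}\right)$. Assumptions. (A1) $\{X(s,0)\}_{s\in S}$ and $\{Y(s,0)\}_{s\in S}$ are centered Gaussian processes with symmetric, positive definite covariance functions having bounded partial derivatives. (The particular choice made is squared exponential, $\operatorname{cov}(X(s_1,0),X(s_2,0))=\sigma_p^2\exp(-\eta_1\|s_1-s_2\|^2)$ and $\operatorname{cov}(Y(s_1,0),Y(s_2,0))=\sigma_\theta^2\exp(-\eta_2\|s_1-s_2\|^2)$, but for example Matérn covariances with smoothness $\nu>1$ are also allowed.) (A2) $V:\mathbb{R}\to\mathbb{R}$ is a zero-mean Gaussian random function with covariance function $c_v(x_1,x_2)=\sigma^2\exp(-\eta_3|x_1-x_2|^2)$; other covariance functions are also allowed, provided they are twice continuously differentiable with Lipschitz continuous mixed partial derivatives (for example rational quadratic, or Matérn with $\nu>2$). Here $\sigma_p,\sigma_\theta,\sigma,\eta_1,\eta_2,\eta_3>0$. $V'$ denotes the derivative of $V$. Dynamics. Fix $\delta t>0$ and real $\alpha,\beta$ with $|\alpha|<1$,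 $|\beta|<1$. For $s\in S$ and $t=h\,\delta t$, $h=0,1,2,\dots$, define recursively $$Y(s,t+\delta t)=\beta Y(s,t)+\frac{\delta t}{M_s}\left(\alpha X(s,t)-\frac{\delta t}{2}V'(Y(s,t))\right),$$ $$X(s,t+\delta t)=\alpha^2X(s,t)-\frac{\delta t}{2}\left\{\alpha V'(Y(s,t))+V'(Y(s,t+\delta t))\right\}.$$ A process $\{Z(s)\}_{s\in S}$ is continuous in the mean square sense if $E|Z(s')-Z(s)|^2\to0$ as $s'\to s$ in $S$, for every $s\in S$. *)

theory Defs
  imports "HOL-Probability.Probability"
begin

section \<open>Gaussian processes\<close>

text \<open>Point masses count as (degenerate) Gaussian laws, as is needed for linear combinations.\<close>

definition gaussian_rv :: "'a measure \<Rightarrow> ('a \<Rightarrow> real) \<Rightarrow> bool" where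
  "gaussian_rv M Z \<longleftrightarrow>
     Z \<in> borel_measurable M \<and>
     (\<exists>\<mu> \<sigma>. (\<sigma> > 0 \<and> distributed M lborel Z (normal_density \<mu> \<sigma>)) \<or>
            (\<sigma> = 0 \<and> (AE \<omega> in M. Z \<omega> = \<mu>)))"

definition gaussian_process :: "'a measure \<Rightarrow> 'i set \<Rightarrow> ('i \<Rightarrow> 'a \<Rightarrow> real) \<Rightarrow> bool" where
  "gaussian_process M I Z \<longleftrightarrow>
     (\<forall>F a. finite F \<and> F \<subseteq> I \<longrightarrow> gaussian_rv M (\<lambda>\<omega>. \<Sum>i\<in>F. a i * Z i \<omega>))"

definition covar :: "'a measure \<Rightarrow> ('a \<Rightarrow> real) \<Rightarrow> ('a \<Rightarrow> real) \<Rightarrow> real" where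
  "covar M Z W =
     (LINT \<omega>|M. (Z \<omega> - (LINT \<omega>'|M. Z \<omega>')) * (W \<omega> - (LINT \<omega>'|M. W \<omega>')))"

definition centered_gaussian_process ::
  "'a measure \<Rightarrow> 'i set \<Rightarrow> ('i \<Rightarrow> 'a \<Rightarrow> real) \<Rightarrow> ('i \<Rightarrow> 'i \<Rightarrow> real) \<Rightarrow> bool" where
  "centered_gaussian_process M I Z k \<longleftrightarrow>
     gaussian_process M I Z \<and>
     (\<forall>i\<in>I. (LINT \<omega>|M. Z i \<omega>) = 0) \<and>
     (\<forall>i\<in>I. \<forall>j\<in>I. covar M (Z i) (Z j) = k i j)"

text \<open>The expectation is taken in \<open>[0, \<infinity>]\<close>, so that convergence to zero is never an artefact
  of a non-integrable integrand.\<close>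

definition mean_square_continuous_on ::
  "'a measure \<Rightarrow> 'i::topological_space set \<Rightarrow> ('i \<Rightarrow> 'a \<Rightarrow> real) \<Rightarrow> bool" where
  "mean_square_continuous_on M S Z \<longleftrightarrow>
     (\<forall>s\<in>S. Z s \<in> borel_measurable M) \<and>
     (\<forall>s\<in>S. ((\<lambda>s'. \<integral>\<^sup>+\<omega>. ennreal (\<bar>Z s' \<omega> - Z s \<omega>\<bar>\<^sup>2) \<partial>M) \<longlongrightarrow> 0) (at s within S))"


section \<open>Covariance functions of the initial processes\<close>

definition symmetric_on :: "'i set \<Rightarrow> ('i \<Rightarrow> 'i \<Rightarrow> real) \<Rightarrow> bool" where
  "symmetric_on I k \<longleftrightarrow> (\<forall>x\<in>I. \<forall>y\<in>I. k x y = k y x)"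

text \<open>Positive definiteness in the sense of positive definite kernels (weak inequality);
  strictly positive definite functions are included.\<close>

definition positive_definite_on :: "'i set \<Rightarrow> ('i \<Rightarrow> 'i \<Rightarrow> real) \<Rightarrow> bool" where
  "positive_definite_on I k \<longleftrightarrow>
     (\<forall>F a. finite F \<and> F \<subseteq> I \<longrightarrow> (\<Sum>x\<in>F. \<Sum>y\<in>F. a x * a y * k x y) \<ge> 0)"

definition bounded_partials_on :: "(real^2) set \<Rightarrow> (real^2 \<Rightarrow> real^2 \<Rightarrow> real) \<Rightarrow> bool" where
  "bounded_partials_on U k \<longleftrightarrow>
     (\<exists>B. \<forall>s\<in>U. \<forall>u\<in>U. \<forall>i.
        (\<exists>D. ((\<lambda>r. k (s + r *\<^sub>R axis i 1) u) has_real_derivative D) (at 0) \<and> \<bar>D\<bar> \<le> B) \<and>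
        (\<exists>D. ((\<lambda>r. k s (u + r *\<^sub>R axis i 1)) has_real_derivative D) (at 0) \<and> \<bar>D\<bar> \<le> B))"

text \<open>Partial derivatives at points of \<open>S\<close> only make sense if the covariance function is given
  on a neighbourhood; the whole plane is the typical choice of \<open>U\<close>.\<close>

definition initial_covariance :: "(real^2) set \<Rightarrow> (real^2 \<Rightarrow> real^2 \<Rightarrow> real) \<Rightarrow> bool" where
  "initial_covariance S k \<longleftrightarrow>
     symmetric_on S k \<and> positive_definite_on S k \<and>
     (\<exists>U. open U \<and> S \<subseteq> U \<and> bounded_partials_on U k)"


section \<open>Covariance functions of the random potential\<close>

text \<open>\<open>ci\<close> and \<open>cij\<close> are the partial derivatives of first and second order, \<open>cij\<close> being the
  derivative of \<open>ci\<close> with respect to the \<open>j\<close>-th argument.\<close>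

definition C2_lipschitz_mixed :: "(real \<Rightarrow> real \<Rightarrow> real) \<Rightarrow> bool" where
  "C2_lipschitz_mixed c \<longleftrightarrow>
     (\<exists>c1 c2 c11 c12 c21 c22.
        (\<forall>x y. ((\<lambda>u. c u y) has_real_derivative c1 x y) (at x) \<and>
               ((\<lambda>v. c x v) has_real_derivative c2 x y) (at y) \<and>
               ((\<lambda>u. c1 u y) has_real_derivative c11 x y) (at x) \<and>
               ((\<lambda>v. c1 x v) has_real_derivative c12 x y) (at y) \<and>
               ((\<lambda>u. c2 u y) has_real_derivative c21 x y) (at x) \<and>
               ((\<lambda>v. c2 x v) has_real_derivative c22 x y) (at y)) \<and>
        (\<forall>g\<in>{c1, c2, c11, c12, c21, c22}. continuous_on UNIV (\<lambda>(x, y). g x y)) \<and>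
        (\<forall>g\<in>{c12, c21}. \<exists>L. L-lipschitz_on UNIV (\<lambda>(x, y). g x y)))"


section \<open>The dynamics\<close>

definition sq_vec :: "real^2 \<Rightarrow> real^2" where
  "sq_vec v = (\<chi> i. (v $ i)\<^sup>2)"

text \<open>For nonempty compact \<open>S\<close> the supremum is a maximum, see \<open>mass_attained\<close>.\<close>

definition mass :: "(real^2) set \<Rightarrow> real^2 \<Rightarrow> real" where
  "mass S s = exp (SUP u\<in>S. (norm (sq_vec s - sq_vec u))\<^sup>2)"

lemma mass_attained:
  assumes "compact S" "S \<noteq> {}"
  shows "\<exists>u\<in>S. mass S s = exp ((norm (sq_vec s - sq_vec u))\<^sup>2) \<and>
           (\<forall>w\<in>S. (norm (sq_vec s - sq_vec w))\<^sup>2 \<le> (norm (sq_vec s - sq_vec u))\<^sup>2)"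
proof -
  let ?f = "\<lambda>u. (norm (sq_vec s - sq_vec u))\<^sup>2"
  have "continuous_on S ?f"
    unfolding sq_vec_def by (intro continuous_intros)
  then obtain u where u: "u \<in> S" "\<forall>w\<in>S. ?f w \<le> ?f u"
    using continuous_attains_sup[OF assms] by blast
  have "(SUP w\<in>S. ?f w) = ?f u"
    using u by (intro cSup_eq_maximum) auto
  with u show ?thesis
    unfolding mass_def by auto
qed

text \<open>\<open>V x \<omega>\<close> is the value at \<open>x\<close> of the sample path \<open>\<omega>\<close> of the potential; only the times
  \<open>h * dt\<close> with natural \<open>h\<close> matter for \<open>X\<close> and \<open>Y\<close>.\<close>

definition potential_deriv :: "(real \<Rightarrow> 'a \<Rightarrow> real) \<Rightarrow> real \<Rightarrow> 'a \<Rightarrow> real" where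
  "potential_deriv V x \<omega> = deriv (\<lambda>u. V u \<omega>) x"

definition hamiltonian_dynamics ::
  "'a measure \<Rightarrow> (real^2) set \<Rightarrow> real \<Rightarrow> real \<Rightarrow> real \<Rightarrow> (real \<Rightarrow> 'a \<Rightarrow> real) \<Rightarrow>
     (real^2 \<Rightarrow> real \<Rightarrow> 'a \<Rightarrow> real) \<Rightarrow> (real^2 \<Rightarrow> real \<Rightarrow> 'a \<Rightarrow> real) \<Rightarrow> bool" where
  "hamiltonian_dynamics M S dt \<alpha> \<beta> V X Y \<longleftrightarrow>
     (\<forall>s\<in>S. \<forall>h::nat. \<forall>\<omega>\<in>space M. let t = real h * dt in
        Y s (t + dt) \<omega> =
          \<beta> * Y s t \<omega> +
          dt / mass S s * (\<alpha> * X s t \<omega> - dt / 2 * potential_deriv V (Y s t \<omega>) \<omega>) \<and>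
        X s (t + dt) \<omega> =
          \<alpha>\<^sup>2 * X s t \<omega> -
          dt / 2 * (\<alpha> * potential_deriv V (Y s t \<omega>) \<omega> +
                    potential_deriv V (Y s (t + dt) \<omega>) \<omega>))"


section \<open>Squared exponential covariances satisfy the regularity conditions\<close>

lemma abs_le_exp_square:
  assumes "\<eta> > (0::real)"
  shows "\<bar>z\<bar> * exp (- \<eta> * z\<^sup>2) \<le> 1 + 1 / \<eta>"
proof -
  have "\<bar>z\<bar> \<le> 1 + z\<^sup>2"
  proof -
    have "0 \<le> (\<bar>z\<bar> - 1)\<^sup>2" by simp
    then show ?thesis by (simp add: power2_diff)
  qed
  also have "\<dots> \<le> (1 + 1 / \<eta>) * (1 + \<eta> * z\<^sup>2)"
    using assms by (simp add: field_simps)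
  also have "\<dots> \<le> (1 + 1 / \<eta>) * exp (\<eta> * z\<^sup>2)"
    using assms by (intro mult_left_mono exp_ge_add_one_self) auto
  finally have "\<bar>z\<bar> * exp (- \<eta> * z\<^sup>2) \<le> (1 + 1 / \<eta>) * exp (\<eta> * z\<^sup>2) * exp (- \<eta> * z\<^sup>2)"
    by (intro mult_right_mono) auto
  also have "\<dots> = 1 + 1 / \<eta>"
    by (simp add: mult.assoc flip: exp_add)
  finally show ?thesis .
qed

lemma bounded_partials_on_sqexp:
  fixes \<sigma> \<eta> :: real
  assumes "\<eta> > 0"
  shows "bounded_partials_on UNIV (\<lambda>s u. \<sigma>\<^sup>2 * exp (- \<eta> * (norm (s - u))\<^sup>2))"
proof -
  define k where "k = (\<lambda>s u :: real^2. \<sigma>\<^sup>2 * exp (- \<eta> * (norm (s - u))\<^sup>2))"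
  define B where "B = 2 * \<eta> * \<sigma>\<^sup>2 * (1 + 1 / \<eta>)"
  have sym: "k s u = k u s" for s u
    by (simp add: k_def norm_minus_commute)
  have main: "\<exists>D. ((\<lambda>r. k (s + r *\<^sub>R axis i 1) u) has_real_derivative D) (at 0) \<and> \<bar>D\<bar> \<le> B"
    for s u i
  proof -
    define d where "d = s - u"
    define z where "z = d $ i"
    have eq: "k (s + r *\<^sub>R axis i 1) u = \<sigma>\<^sup>2 * exp (- \<eta> * ((norm d)\<^sup>2 + 2 * r * z + r\<^sup>2))" for r
    proof -
      have "s + r *\<^sub>R axis i 1 - u = d + r *\<^sub>R axis i 1"
        by (simp add: d_def)
      moreover have "(norm (d + r *\<^sub>R axis i 1))\<^sup>2 = (norm d)\<^sup>2 + 2 * r * z + r\<^sup>2"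
        unfolding power2_norm_eq_inner
        by (simp add: inner_add_left inner_add_right inner_axis inner_axis'
            z_def power2_eq_square algebra_simps)
      ultimately show ?thesis
        by (simp only: k_def)
    qed
    have "((\<lambda>r. k (s + r *\<^sub>R axis i 1) u) has_real_derivative
            \<sigma>\<^sup>2 * (exp (- \<eta> * (norm d)\<^sup>2) * (- \<eta> * (2 * z)))) (at 0)"
      unfolding eq by (auto intro!: derivative_eq_intros)
    moreover have "\<bar>\<sigma>\<^sup>2 * (exp (- \<eta> * (norm d)\<^sup>2) * (- \<eta> * (2 * z)))\<bar> \<le> B"
    proof -
      have "z\<^sup>2 \<le> (norm d)\<^sup>2"
        using component_le_norm_cart[of d i] by (simp add: z_def abs_le_square_iff[symmetric])
      then have "exp (- \<eta> * (norm d)\<^sup>2) \<le> exp (- \<eta> * z\<^sup>2)"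
        using assms by simp
      then have "\<bar>z\<bar> * exp (- \<eta> * (norm d)\<^sup>2) \<le> 1 + 1 / \<eta>"
        using abs_le_exp_square[OF assms, of z] by (meson abs_ge_zero mult_left_mono order_trans)
      then have "2 * \<eta> * \<sigma>\<^sup>2 * (\<bar>z\<bar> * exp (- \<eta> * (norm d)\<^sup>2)) \<le> B"
        unfolding B_def using assms by (intro mult_left_mono) auto
      then show ?thesis
        using assms by (simp add: abs_mult algebra_simps)
    qed
    ultimately show ?thesis by blast
  qed
  have "bounded_partials_on UNIV k"
    unfolding bounded_partials_on_def
    using main main[folded sym] by blast
  then show ?thesis by (simp add: k_def)
qed

lemma C2_lipschitz_mixed_sqexp:
  fixes \<sigma> \<eta> :: real
  assumes "\<eta> > 0"
  shows "C2_lipschitz_mixed (\<lambda>x y. \<sigma>\<^sup>2 * exp (- \<eta> * \<bar>x - y\<bar>\<^sup>2))"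
proof -
  define g where "g = (\<lambda>r. \<sigma>\<^sup>2 * exp (- \<eta> * r\<^sup>2))"
  define g1 where "g1 = (\<lambda>r. (- 2 * \<eta> * r) * g r)"
  define g2 where "g2 = (\<lambda>r. (4 * \<eta>\<^sup>2 * r\<^sup>2 - 2 * \<eta>) * g r)"
  define g3 where "g3 = (\<lambda>r. (12 * \<eta>\<^sup>2 * r - 8 * \<eta>^3 * r^3) * g r)"
  have d0: "(g has_real_derivative g1 r) (at r)" for r
    unfolding g_def g1_def by (auto intro!: derivative_eq_intros)
  have d1: "(g1 has_real_derivative g2 r) (at r)" for r
  proof -
    have "(g1 has_real_derivative (- 2 * \<eta>) * g r + g1 r * (- 2 * \<eta> * r)) (at r)"
      unfolding g1_def by (auto intro!: derivative_eq_intros d0 simp: g1_def)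
    then show ?thesis
      by (rule DERIV_cong) (simp add: g1_def g2_def algebra_simps power2_eq_square)
  qed
  have d2: "(g2 has_real_derivative g3 r) (at r)" for r
  proof -
    have "(g2 has_real_derivative (8 * \<eta>\<^sup>2 * r) * g r + g1 r * (4 * \<eta>\<^sup>2 * r\<^sup>2 - 2 * \<eta>)) (at r)"
      unfolding g2_def by (auto intro!: derivative_eq_intros d0)
    then show ?thesis
      by (rule DERIV_cong) (simp add: g1_def g3_def algebra_simps power2_eq_square power3_eq_cube)
  qed
  define L where "L = \<sigma>\<^sup>2 * (12 * \<eta>\<^sup>2 * (1 + 1 / \<eta>) + 8 * \<eta>^3 * ((1 + 3 / \<eta>)^3))"
  have L: "\<bar>g3 r\<bar> \<le> L" for r
  proof -
    define e where "e = exp (- \<eta> * r\<^sup>2)"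
    have a: "\<bar>r\<bar> * e \<le> 1 + 1 / \<eta>"
      using abs_le_exp_square[OF assms] by (simp add: e_def)
    define f where "f = exp (- (\<eta> / 3) * r\<^sup>2)"
    have ef: "e = f * f * f"
      by (simp add: e_def f_def flip: exp_add)
    have "\<bar>r\<bar> * f \<le> 1 + 1 / (\<eta> / 3)"
      unfolding f_def using assms by (intro abs_le_exp_square) auto
    then have b0: "\<bar>r\<bar> * f \<le> 1 + 3 / \<eta>" by simp
    have "\<bar>r\<bar>^3 * e = (\<bar>r\<bar> * f)^3"
      by (simp add: ef power_mult_distrib power3_eq_cube)
    also have "\<dots> \<le> (1 + 3 / \<eta>)^3"
      using b0 by (intro power_mono) (auto simp: f_def)
    finally have b: "\<bar>r\<bar>^3 * e \<le> (1 + 3 / \<eta>)^3" .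
    have "e \<ge> 0" by (simp add: e_def)
    have "\<bar>g3 r\<bar> = \<sigma>\<^sup>2 * (\<bar>12 * \<eta>\<^sup>2 * r - 8 * \<eta>^3 * r^3\<bar> * e)"
      by (simp add: g3_def g_def e_def abs_mult)
    also have "\<dots> \<le> \<sigma>\<^sup>2 * ((12 * \<eta>\<^sup>2 * \<bar>r\<bar> + 8 * \<eta>^3 * \<bar>r\<bar>^3) * e)"
    proof (intro mult_left_mono mult_right_mono)
      show "\<bar>12 * \<eta>\<^sup>2 * r - 8 * \<eta>^3 * r^3\<bar> \<le> 12 * \<eta>\<^sup>2 * \<bar>r\<bar> + 8 * \<eta>^3 * \<bar>r\<bar>^3"
        using abs_triangle_ineq4[of "12 * \<eta>\<^sup>2 * r" "8 * \<eta>^3 * r^3"] assms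
        by (simp add: abs_mult power_abs)
    qed (use \<open>e \<ge> 0\<close> in auto)
    also have "\<dots> = \<sigma>\<^sup>2 * (12 * \<eta>\<^sup>2 * (\<bar>r\<bar> * e) + 8 * \<eta>^3 * (\<bar>r\<bar>^3 * e))"
      by (simp add: algebra_simps)
    also have "\<dots> \<le> L"
      unfolding L_def using a b assms by (intro mult_left_mono add_mono) auto
    finally show ?thesis .
  qed
  have lip: "\<bar>g2 a - g2 b\<bar> \<le> L * \<bar>a - b\<bar>" for a b
    using field_differentiable_bound[of UNIV g2 g3 L a b] d2 L by auto
  have "0 \<le> L" using L[of 0] by (smt (verit))
  have lip2: "(2 * L)-lipschitz_on UNIV (\<lambda>(x, y). - g2 (x - y))"
  proof (rule lipschitz_onI)
    fix p q :: "real \<times> real"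
    obtain x y x' y' where pq: "p = (x, y)" "q = (x', y')" by (metis surj_pair)
    have "\<bar>(x - y) - (x' - y')\<bar> \<le> 2 * dist p q"
      using dist_fst_le[of p q] dist_snd_le[of p q] by (simp add: pq dist_real_def)
    then have "L * \<bar>(x - y) - (x' - y')\<bar> \<le> L * (2 * dist p q)"
      using \<open>0 \<le> L\<close> by (rule mult_left_mono)
    with lip[of "x - y" "x' - y'"]
    show "dist ((\<lambda>(x, y). - g2 (x - y)) p) ((\<lambda>(x, y). - g2 (x - y)) q) \<le> 2 * L * dist p q"
      by (simp add: pq dist_real_def)
  qed (use \<open>0 \<le> L\<close> in simp)
  have chain: "((\<lambda>u. f (u - y)) has_real_derivative f' (x - y)) (at x)"
      "((\<lambda>v. f (x - v)) has_real_derivative - f' (x - y)) (at y)"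
      if "\<And>r. (f has_real_derivative f' r) (at r)" for f f' :: "real \<Rightarrow> real" and x y
  proof -
    have "((\<lambda>u. u - y) has_real_derivative 1) (at x)" "((\<lambda>v. x - v) has_real_derivative - 1) (at y)"
      by (auto intro!: derivative_eq_intros)
    from this[THEN DERIV_chain2[OF that]]
    show "((\<lambda>u. f (u - y)) has_real_derivative f' (x - y)) (at x)"
      "((\<lambda>v. f (x - v)) has_real_derivative - f' (x - y)) (at y)"
      by simp_all
  qed
  have cont: "continuous_on UNIV (\<lambda>(x, y). f (x - y))"
      if "\<And>r. (f has_real_derivative f' r) (at r)" for f f' :: "real \<Rightarrow> real"
  proof -
    have "continuous_on UNIV f"
      using that by (meson DERIV_isCont continuous_at_imp_continuous_on)
    then have "continuous_on UNIV (\<lambda>p :: real \<times> real. f (fst p - snd p))"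
      by (rule continuous_on_compose2) (auto intro!: continuous_intros)
    then show ?thesis by (simp add: case_prod_beta)
  qed
  have cont': "continuous_on UNIV (\<lambda>(x, y). - f (x - y))"
      if "\<And>r. (f has_real_derivative f' r) (at r)" for f f' :: "real \<Rightarrow> real"
    using continuous_on_minus[OF cont[OF that]] by (simp add: case_prod_beta)
  have "C2_lipschitz_mixed (\<lambda>x y. g (x - y))"
    unfolding C2_lipschitz_mixed_def
  proof (intro exI conjI allI)
    fix x y
    show "((\<lambda>u. g (u - y)) has_real_derivative g1 (x - y)) (at x)"
      "((\<lambda>v. g (x - v)) has_real_derivative - g1 (x - y)) (at y)"
      "((\<lambda>u. g1 (u - y)) has_real_derivative g2 (x - y)) (at x)"
      "((\<lambda>v. g1 (x - v)) has_real_derivative - g2 (x - y)) (at y)"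
      using chain[OF d0] chain[OF d1] by auto
    show "((\<lambda>u. - g1 (u - y)) has_real_derivative - g2 (x - y)) (at x)"
      using DERIV_minus[OF chain(1)[OF d1]] .
    show "((\<lambda>v. - g1 (x - v)) has_real_derivative g2 (x - y)) (at y)"
      using DERIV_minus[OF chain(2)[OF d1]] by simp
  qed (use cont[OF d1] cont[OF d2] cont'[OF d1] cont'[OF d2] lip2 in auto)
  then show ?thesis by (simp add: g_def)
qed

end

theory Submission
  imports Defs
begin

text \<open>The induction on \<open>h\<close> keeps two properties of \<open>X\<close> and \<open>Y\<close> at once: mean square continuity
  in \<open>s\<close>, and moments of every order that are bounded uniformly in \<open>s\<close>. The only nonlinear
  operation is \<open>Z \<mapsto> V' (Z)\<close>. Since \<open>V\<close> may depend on \<open>Z\<close>, conditioning on \<open>Z\<close> is impossible;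
  a pathwise estimate is used instead. Differences of adjacent dyadic slopes of \<open>V\<close> (kinks) are
  Gaussian with variance \<open>O(2\<^sup>-\<^sup>n)\<close> at level \<open>n\<close>, because the mixed derivative of the covariance is
  Lipschitz. Summing high moments over all levels and positions gives one random variable \<open>G\<close>
  with all moments that controls every kink up to the weight \<open>(4/5)\<^sup>n (1 + |x|)\<close>. As dyadic slopes
  converge to \<open>V'\<close>, chaining yields a Hoelder type modulus and polynomial growth of \<open>V'\<close> with
  random constant \<open>G\<close>, and the moments of \<open>G\<close> and \<open>Z\<close> do the rest.\<close>

section \<open>Uniformly bounded moments\<close>

text \<open>The hypotheses give a Gaussian law to \<open>V\<close> only, and differentiable paths;
  neither the law nor the continuity of \<open>V'\<close> is among them. So all probability is done
  on values of \<open>V\<close> at dyadic points: slopes and kinks are finite linear combinations of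
  them, hence Gaussian, and there are countably many, so that a single null set serves every path
  argument. Random points can then be inserted into the resulting pathwise bounds, whatever their
  dependence on \<open>V\<close>. The processes are unbounded, so the bounds must hold on the whole
  line; this forces a weight that grows with the position, and it leaves \<open>V'\<close> with
  quadratic growth. Each time step therefore multiplies a random constant by powers of the process
  and consumes moments of higher order than it returns. Asking for all orders at once is what makes
  the induction hypothesis reproduce itself. A Hoelder bound with a random constant does not combine
  directly with mean square continuity, since the constant multiplies the increment. The way out is
  a fixed dyadic level: its error is small in mean square by moments alone, and at that level the
  increment can be freed from the random factor.\<close>

definition bounded_moments :: "'a measure \<Rightarrow> 'i set \<Rightarrow> ('i \<Rightarrow> 'a \<Rightarrow> real) \<Rightarrow> bool" where
  "bounded_moments M I Z \<longleftrightarrow>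
     (\<forall>i\<in>I. Z i \<in> borel_measurable M) \<and>
     (\<forall>m::nat. \<exists>B::real. \<forall>i\<in>I. (\<integral>\<^sup>+\<omega>. ennreal (\<bar>Z i \<omega>\<bar> ^ m) \<partial>M) \<le> ennreal B)"

lemma bounded_momentsI:
  assumes "\<And>i. i \<in> I \<Longrightarrow> Z i \<in> borel_measurable M"
    and "\<And>m::nat. \<exists>B::real. \<forall>i\<in>I. (\<integral>\<^sup>+\<omega>. ennreal (\<bar>Z i \<omega>\<bar> ^ m) \<partial>M) \<le> ennreal B"
  shows "bounded_moments M I Z"
  using assms unfolding bounded_moments_def by blast

lemma bounded_moments_measurable:
  "bounded_moments M I Z \<Longrightarrow> i \<in> I \<Longrightarrow> Z i \<in> borel_measurable M"
  unfolding bounded_moments_def by blast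

lemma bounded_momentsE:
  assumes "bounded_moments M I Z"
  obtains B :: real where "B \<ge> 0"
    "\<And>i. i \<in> I \<Longrightarrow> (\<integral>\<^sup>+\<omega>. ennreal (\<bar>Z i \<omega>\<bar> ^ m) \<partial>M) \<le> ennreal B"
proof -
  obtain B where "\<forall>i\<in>I. (\<integral>\<^sup>+\<omega>. ennreal (\<bar>Z i \<omega>\<bar> ^ m) \<partial>M) \<le> ennreal B"
    using assms unfolding bounded_moments_def by blast
  then show ?thesis
    by (intro that[of "max B 0"]) (auto intro!: order_trans[OF _ ennreal_leI[OF max.cobounded1]])
qed

text \<open>Index sets are kept arbitrary on purpose: a single random constant is a family over
  \<open>unit\<close>, while bounds on increments concern families over \<open>S \<times> S\<close>.
  Changing the index brings them together in one product.\<close>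

lemma bounded_moments_reindex:
  assumes "bounded_moments M I Z" "\<And>j. j \<in> J \<Longrightarrow> g j \<in> I"
  shows "bounded_moments M J (\<lambda>j. Z (g j))"
  using assms unfolding bounded_moments_def by meson

text \<open>Domination almost everywhere is the right form, because the growth bound on the
  derivative of the potential fails on a null set.\<close>

lemma bounded_moments_dominated:
  assumes W: "bounded_moments M I W"
    and "\<And>i. i \<in> I \<Longrightarrow> Z i \<in> borel_measurable M"
    and "\<And>i. i \<in> I \<Longrightarrow> AE \<omega> in M. \<bar>Z i \<omega>\<bar> \<le> \<bar>W i \<omega>\<bar>"
  shows "bounded_moments M I Z"
proof (rule bounded_momentsI)
  fix m
  obtain B where B: "\<And>i. i \<in> I \<Longrightarrow> (\<integral>\<^sup>+\<omega>. ennreal (\<bar>W i \<omega>\<bar> ^ m) \<partial>M) \<le> ennreal B"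
    using bounded_momentsE[OF W] by blast
  have "(\<integral>\<^sup>+\<omega>. ennreal (\<bar>Z i \<omega>\<bar> ^ m) \<partial>M) \<le> ennreal B" if "i \<in> I" for i
  proof -
    have "(\<integral>\<^sup>+\<omega>. ennreal (\<bar>Z i \<omega>\<bar> ^ m) \<partial>M) \<le> (\<integral>\<^sup>+\<omega>. ennreal (\<bar>W i \<omega>\<bar> ^ m) \<partial>M)"
      using assms(3)[OF that]
      by (intro nn_integral_mono_AE) (auto elim!: eventually_mono intro!: ennreal_leI power_mono)
    also have "\<dots> \<le> ennreal B" by (rule B[OF that])
    finally show ?thesis .
  qed
  then show "\<exists>B::real. \<forall>i\<in>I. (\<integral>\<^sup>+\<omega>. ennreal (\<bar>Z i \<omega>\<bar> ^ m) \<partial>M) \<le> ennreal B" by blast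
qed (use assms in auto)

text \<open>On a probability space \<open>1 + \<bar>x\<bar> ^ p\<close> dominates every lower power.
  Arbitrarily high orders therefore suffice, which matters because the Gaussian formula covers even
  orders and the series of kinks converges only for large ones.\<close>

lemma bounded_moments_cofinal:
  assumes "prob_space M"
    and meas: "\<And>i. i \<in> I \<Longrightarrow> Z i \<in> borel_measurable M"
    and mom: "\<And>m::nat. \<exists>p\<ge>m. \<exists>B::real. \<forall>i\<in>I. (\<integral>\<^sup>+\<omega>. ennreal (\<bar>Z i \<omega>\<bar> ^ p) \<partial>M) \<le> ennreal B"
  shows "bounded_moments M I Z"
proof (rule bounded_momentsI)
  fix m :: nat
  interpret prob_space M by fact
  obtain p B where p: "p \<ge> m"
    and B: "\<And>i. i \<in> I \<Longrightarrow> (\<integral>\<^sup>+\<omega>. ennreal (\<bar>Z i \<omega>\<bar> ^ p) \<partial>M) \<le> ennreal B"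
    using mom by meson
  have "(\<integral>\<^sup>+\<omega>. ennreal (\<bar>Z i \<omega>\<bar> ^ m) \<partial>M) \<le> ennreal (1 + max B 0)" if i: "i \<in> I" for i
  proof -
    note [measurable] = meas[OF i]
    have le: "\<bar>x\<bar> ^ m \<le> 1 + \<bar>x\<bar> ^ p" for x :: real
    proof (cases "\<bar>x\<bar> \<le> 1")
      case True
      then have "\<bar>x\<bar> ^ m \<le> 1" by (simp add: power_le_one)
      then show ?thesis by (simp add: add_increasing2)
    next
      case False
      then have "\<bar>x\<bar> ^ m \<le> \<bar>x\<bar> ^ p" using p by (intro power_increasing) auto
      then show ?thesis by simp
    qed
    have "(\<integral>\<^sup>+\<omega>. ennreal (\<bar>Z i \<omega>\<bar> ^ m) \<partial>M) \<le> (\<integral>\<^sup>+\<omega>. 1 + ennreal (\<bar>Z i \<omega>\<bar> ^ p) \<partial>M)"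
      by (intro nn_integral_mono) (simp add: le flip: ennreal_1 ennreal_plus)
    also have "\<dots> = 1 + (\<integral>\<^sup>+\<omega>. ennreal (\<bar>Z i \<omega>\<bar> ^ p) \<partial>M)"
      by (subst nn_integral_add) (auto simp: emeasure_space_1)
    also have "\<dots> \<le> 1 + ennreal (max B 0)"
      by (intro add_left_mono order_trans[OF B[OF i]] ennreal_leI) simp
    finally show ?thesis by (simp add: ennreal_plus)
  qed
  then show "\<exists>B::real. \<forall>i\<in>I. (\<integral>\<^sup>+\<omega>. ennreal (\<bar>Z i \<omega>\<bar> ^ m) \<partial>M) \<le> ennreal B" by blast
qed (rule meas)

lemma bounded_moments_of_bounded:
  assumes "prob_space M" and "\<And>i. i \<in> I \<Longrightarrow> \<bar>f i\<bar> \<le> C"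
  shows "bounded_moments M I (\<lambda>i \<omega>. f i)"
proof (rule bounded_momentsI)
  fix m :: nat
  interpret prob_space M by fact
  have "(\<integral>\<^sup>+\<omega>. ennreal (\<bar>f i\<bar> ^ m) \<partial>M) \<le> ennreal (C ^ m)" if "i \<in> I" for i
    using assms(2)[OF that]
    by (simp add: emeasure_space_1 power_mono ennreal_leI)
  then show "\<exists>B::real. \<forall>i\<in>I. (\<integral>\<^sup>+\<omega>. ennreal (\<bar>f i\<bar> ^ m) \<partial>M) \<le> ennreal B" by blast
qed auto

lemma bounded_moments_const:
  assumes "prob_space M"
  shows "bounded_moments M I (\<lambda>i \<omega>. C)"
  by (rule bounded_moments_of_bounded[OF assms order_refl])

text \<open>Order \<open>m\<close> of a product costs order \<open>2 * m\<close> of both factors, so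
  closure under products is only available for all orders together.\<close>

lemma bounded_moments_mult:
  assumes Z: "bounded_moments M I Z" and W: "bounded_moments M I W"
  shows "bounded_moments M I (\<lambda>i \<omega>. Z i \<omega> * W i \<omega>)"
proof (rule bounded_momentsI)
  fix i assume "i \<in> I"
  then show "(\<lambda>\<omega>. Z i \<omega> * W i \<omega>) \<in> borel_measurable M"
    using Z W by (intro borel_measurable_times bounded_moments_measurable)
next
  fix m
  obtain B where B: "B \<ge> 0" "\<And>i. i \<in> I \<Longrightarrow> (\<integral>\<^sup>+\<omega>. ennreal (\<bar>Z i \<omega>\<bar> ^ (2*m)) \<partial>M) \<le> ennreal B"
    using bounded_momentsE[OF Z] by blast
  obtain C where C: "C \<ge> 0" "\<And>i. i \<in> I \<Longrightarrow> (\<integral>\<^sup>+\<omega>. ennreal (\<bar>W i \<omega>\<bar> ^ (2*m)) \<partial>M) \<le> ennreal C"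
    using bounded_momentsE[OF W] by blast
  have "(\<integral>\<^sup>+\<omega>. ennreal (\<bar>Z i \<omega> * W i \<omega>\<bar> ^ m) \<partial>M) \<le> ennreal (B + C)" if i: "i \<in> I" for i
  proof -
    note [measurable] = bounded_moments_measurable[OF Z i] bounded_moments_measurable[OF W i]
    have le: "\<bar>x * y\<bar> ^ m \<le> \<bar>x\<bar> ^ (2*m) + \<bar>y\<bar> ^ (2*m)" for x y :: real
    proof -
      \<comment> \<open>Adding the two squares to the usual one gives
        \<open>a * b <= a^2 + b^2\<close> without a factor 1/2.\<close>
      have "0 \<le> (\<bar>x\<bar> ^ m - \<bar>y\<bar> ^ m)\<^sup>2 + (\<bar>x\<bar> ^ m)\<^sup>2 + (\<bar>y\<bar> ^ m)\<^sup>2" by simp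
      then show ?thesis
        by (simp add: power2_diff abs_mult power_mult_distrib mult.commute[of 2 m] power_mult)
    qed
    have "(\<integral>\<^sup>+\<omega>. ennreal (\<bar>Z i \<omega> * W i \<omega>\<bar> ^ m) \<partial>M)
        \<le> (\<integral>\<^sup>+\<omega>. ennreal (\<bar>Z i \<omega>\<bar> ^ (2*m)) + ennreal (\<bar>W i \<omega>\<bar> ^ (2*m)) \<partial>M)"
      by (intro nn_integral_mono) (simp add: le del: power_mult flip: ennreal_plus)
    also have "\<dots> \<le> ennreal B + ennreal C"
      using B(2)[OF i] C(2)[OF i] by (subst nn_integral_add) (auto intro!: add_mono)
    finally show ?thesis using B(1) C(1) by (simp add: ennreal_plus)
  qed
  then show "\<exists>B::real. \<forall>i\<in>I. (\<integral>\<^sup>+\<omega>. ennreal (\<bar>Z i \<omega> * W i \<omega>\<bar> ^ m) \<partial>M) \<le> ennreal B" by blast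
qed

lemma bounded_moments_add:
  assumes Z: "bounded_moments M I Z" and W: "bounded_moments M I W"
  shows "bounded_moments M I (\<lambda>i \<omega>. Z i \<omega> + W i \<omega>)"
proof (rule bounded_momentsI)
  fix i assume "i \<in> I"
  then show "(\<lambda>\<omega>. Z i \<omega> + W i \<omega>) \<in> borel_measurable M"
    using Z W by (intro borel_measurable_add bounded_moments_measurable)
next
  fix m :: nat
  obtain B where B: "B \<ge> 0" "\<And>i. i \<in> I \<Longrightarrow> (\<integral>\<^sup>+\<omega>. ennreal (\<bar>Z i \<omega>\<bar> ^ m) \<partial>M) \<le> ennreal B"
    using bounded_momentsE[OF Z] by blast
  obtain C where C: "C \<ge> 0" "\<And>i. i \<in> I \<Longrightarrow> (\<integral>\<^sup>+\<omega>. ennreal (\<bar>W i \<omega>\<bar> ^ m) \<partial>M) \<le> ennreal C"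
    using bounded_momentsE[OF W] by blast
  have "(\<integral>\<^sup>+\<omega>. ennreal (\<bar>Z i \<omega> + W i \<omega>\<bar> ^ m) \<partial>M) \<le> ennreal (2 ^ m * (B + C))" if i: "i \<in> I" for i
  proof -
    note [measurable] = bounded_moments_measurable[OF Z i] bounded_moments_measurable[OF W i]
    have le: "\<bar>x + y\<bar> ^ m \<le> 2 ^ m * (\<bar>x\<bar> ^ m + \<bar>y\<bar> ^ m)" for x y :: real
    proof -
      have "\<bar>x + y\<bar> ^ m \<le> (2 * max \<bar>x\<bar> \<bar>y\<bar>) ^ m"
        by (intro power_mono) auto
      also have "\<dots> = 2 ^ m * max \<bar>x\<bar> \<bar>y\<bar> ^ m" by (simp add: power_mult_distrib)
      also have "\<dots> \<le> 2 ^ m * (\<bar>x\<bar> ^ m + \<bar>y\<bar> ^ m)"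
        by (intro mult_left_mono) (auto simp: max_def)
      finally show ?thesis .
    qed
    have "(\<integral>\<^sup>+\<omega>. ennreal (\<bar>Z i \<omega> + W i \<omega>\<bar> ^ m) \<partial>M)
        \<le> (\<integral>\<^sup>+\<omega>. ennreal (2 ^ m) * (ennreal (\<bar>Z i \<omega>\<bar> ^ m) + ennreal (\<bar>W i \<omega>\<bar> ^ m)) \<partial>M)"
      by (intro nn_integral_mono) (simp add: le flip: ennreal_plus ennreal_mult)
    also have "\<dots> = ennreal (2 ^ m) * ((\<integral>\<^sup>+\<omega>. ennreal (\<bar>Z i \<omega>\<bar> ^ m) \<partial>M) + (\<integral>\<^sup>+\<omega>. ennreal (\<bar>W i \<omega>\<bar> ^ m) \<partial>M))"
      by (simp add: nn_integral_cmult nn_integral_add)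
    also have "\<dots> \<le> ennreal (2 ^ m) * (ennreal B + ennreal C)"
      using B(2)[OF i] C(2)[OF i] by (intro mult_left_mono add_mono) auto
    finally show ?thesis using B(1) C(1) by (simp add: ennreal_mult flip: ennreal_plus)
  qed
  then show "\<exists>B::real. \<forall>i\<in>I. (\<integral>\<^sup>+\<omega>. ennreal (\<bar>Z i \<omega> + W i \<omega>\<bar> ^ m) \<partial>M) \<le> ennreal B" by blast
qed

lemma bounded_moments_abs:
  assumes "bounded_moments M I Z"
  shows "bounded_moments M I (\<lambda>i \<omega>. \<bar>Z i \<omega>\<bar>)"
  using assms unfolding bounded_moments_def by auto

section \<open>Gaussian moments\<close>

text \<open>The factor is the double factorial (2m-1)!!. For a point mass, mean zero puts the mass
  at 0, and both sides are 0, or 1 when \<open>m = 0\<close>.\<close>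

lemma gaussian_rv_moments:
  assumes "prob_space M" and "gaussian_rv M Z"
  shows "integrable M (\<lambda>\<omega>. Z \<omega> ^ k)"
    and "(LINT \<omega>|M. Z \<omega>) = 0 \<Longrightarrow>
      (LINT \<omega>|M. Z \<omega> ^ (2 * m)) = fact (2 * m) / (2 ^ m * fact m) * (LINT \<omega>|M. (Z \<omega>)\<^sup>2) ^ m"
proof -
  interpret prob_space M by fact
  have [measurable]: "Z \<in> borel_measurable M" using assms(2) by (simp add: gaussian_rv_def)
  obtain \<mu> \<sigma> where *: "(\<sigma> > 0 \<and> distributed M lborel Z (normal_density \<mu> \<sigma>)) \<or>
            (\<sigma> = 0 \<and> (AE \<omega> in M. Z \<omega> = \<mu>))"
    using assms(2) unfolding gaussian_rv_def by blast
  have "integrable M (\<lambda>\<omega>. Z \<omega> ^ k) \<and> ((LINT \<omega>|M. Z \<omega>) = 0 \<longrightarrow>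
      (LINT \<omega>|M. Z \<omega> ^ (2 * m)) = fact (2 * m) / (2 ^ m * fact m) * (LINT \<omega>|M. (Z \<omega>)\<^sup>2) ^ m)"
    using *
  proof
    assume "\<sigma> > 0 \<and> distributed M lborel Z (normal_density \<mu> \<sigma>)"
    then have \<sigma>: "\<sigma> > 0" and d: "distributed M lborel Z (normal_density \<mu> \<sigma>)" by auto
    have i: "integrable M (\<lambda>\<omega>. (Z \<omega> - \<mu>) ^ j)" for j
      using distributed_integrable[OF d, of "\<lambda>x. (x - \<mu>) ^ j"] integrable_normal_moment[OF \<sigma>]
      by simp
    \<comment> \<open>The normal moments are available around the mean; the binomial theorem moves
      them to the origin.\<close>
    have "integrable M (\<lambda>\<omega>. \<Sum>j\<le>k. of_nat (k choose j) * (Z \<omega> - \<mu>) ^ j * \<mu> ^ (k - j))"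
      using i by auto
    then have "integrable M (\<lambda>\<omega>. Z \<omega> ^ k)"
      by (simp add: binomial_ring[symmetric])
    moreover {
      assume "(LINT \<omega>|M. Z \<omega>) = 0"
      then have \<mu>: "\<mu> = 0" using normal_distributed_expectation[OF \<sigma> d] by simp
      have mom: "(LINT \<omega>|M. Z \<omega> ^ (2 * j)) = fact (2 * j) / ((2 / \<sigma>\<^sup>2)^j * fact j)" for j
        using distributed_integral[OF d, of "\<lambda>x. x ^ (2*j)"]
          integral_normal_moment_even[OF \<sigma>, of \<mu> j] \<mu> by simp
      have "(LINT \<omega>|M. (Z \<omega>)\<^sup>2) = \<sigma>\<^sup>2"
        using mom[of 1] \<sigma> by (simp add: field_simps power2_eq_square)
      then have "(LINT \<omega>|M. Z \<omega> ^ (2 * m)) = fact (2 * m) / (2 ^ m * fact m) * (LINT \<omega>|M. (Z \<omega>)\<^sup>2) ^ m"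
        unfolding mom using \<sigma> by (simp add: power_divide)
    }
    ultimately show ?thesis by blast
  next
    assume "\<sigma> = 0 \<and> (AE \<omega> in M. Z \<omega> = \<mu>)"
    then have ae: "AE \<omega> in M. Z \<omega> = \<mu>" by simp
    have ae_pow: "AE \<omega> in M. Z \<omega> ^ j = \<mu> ^ j" for j
      using ae by (auto elim: eventually_mono)
    have int: "(LINT \<omega>|M. Z \<omega> ^ j) = \<mu> ^ j" for j
      using integral_cong_AE[OF _ _ ae_pow[of j]] by (simp add: prob_space)
    have "integrable M (\<lambda>\<omega>. Z \<omega> ^ k)"
      using integrable_cong_AE[OF _ _ ae_pow[of k]] by simp
    moreover have "(LINT \<omega>|M. Z \<omega>) = \<mu>" using int[of 1] by simp
    moreover have "(LINT \<omega>|M. Z \<omega> ^ (2 * m)) = fact (2 * m) / (2 ^ m * fact m) * (LINT \<omega>|M. (Z \<omega>)\<^sup>2) ^ m"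
      if "\<mu> = 0"
      unfolding int that by (cases "m = 0") (simp_all add: power_0_left)
    ultimately show ?thesis by simp
  qed
  then show "integrable M (\<lambda>\<omega>. Z \<omega> ^ k)" and "(LINT \<omega>|M. Z \<omega>) = 0 \<Longrightarrow>
      (LINT \<omega>|M. Z \<omega> ^ (2 * m)) = fact (2 * m) / (2 ^ m * fact m) * (LINT \<omega>|M. (Z \<omega>)\<^sup>2) ^ m"
    by auto
qed

lemma gaussian_process_component:
  assumes "gaussian_process M I Z" "i \<in> I"
  shows "gaussian_rv M (Z i)"
  using assms(1)[unfolded gaussian_process_def, rule_format, of "{i}" "\<lambda>_. 1"] assms(2) by simp

text \<open>Used with explicit sets of one, two or three indices: values, increments and kinks.
  Their variances become short expressions in the covariance.\<close>

lemma centered_gaussian_process_sum: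
  assumes "prob_space M" and cg: "centered_gaussian_process M I Z k" and F: "finite F" "F \<subseteq> I"
  shows "gaussian_rv M (\<lambda>\<omega>. \<Sum>i\<in>F. a i * Z i \<omega>)"
    and "(LINT \<omega>|M. (\<Sum>i\<in>F. a i * Z i \<omega>)) = 0"
    and "(LINT \<omega>|M. (\<Sum>i\<in>F. a i * Z i \<omega>)\<^sup>2) = (\<Sum>i\<in>F. \<Sum>j\<in>F. a i * a j * k i j)"
proof -
  have gp: "gaussian_process M I Z" and mean: "\<And>i. i \<in> I \<Longrightarrow> (LINT \<omega>|M. Z i \<omega>) = 0"
    and cov: "\<And>i j. i \<in> I \<Longrightarrow> j \<in> I \<Longrightarrow> covar M (Z i) (Z j) = k i j"
    using cg unfolding centered_gaussian_process_def by auto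
  show "gaussian_rv M (\<lambda>\<omega>. \<Sum>i\<in>F. a i * Z i \<omega>)"
    using gp F unfolding gaussian_process_def by blast
  have g: "gaussian_rv M (Z i)" if "i \<in> F" for i
    using gaussian_process_component[OF gp] that F by blast
  have int: "integrable M (\<lambda>\<omega>. Z i \<omega> ^ n)" if "i \<in> F" for i n
    by (rule gaussian_rv_moments(1)[OF assms(1) g[OF that]])
  \<comment> \<open>Exchanging integral and double sum needs integrable products, which follow from
    \<open>\<bar>x * y\<bar> <= x^2 + y^2\<close>.\<close>
  have int2: "integrable M (\<lambda>\<omega>. Z i \<omega> * Z j \<omega>)" if "i \<in> F" "j \<in> F" for i j
  proof (rule Bochner_Integration.integrable_bound)
    show "integrable M (\<lambda>\<omega>. (Z i \<omega>)\<^sup>2 + (Z j \<omega>)\<^sup>2)" using int that by auto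
    show "(\<lambda>\<omega>. Z i \<omega> * Z j \<omega>) \<in> borel_measurable M"
      using int[of i 1] int[of j 1] that by (auto intro!: borel_measurable_times)
    show "AE \<omega> in M. norm (Z i \<omega> * Z j \<omega>) \<le> norm ((Z i \<omega>)\<^sup>2 + (Z j \<omega>)\<^sup>2)"
    proof (intro AE_I2)
      fix \<omega>
      show "norm (Z i \<omega> * Z j \<omega>) \<le> norm ((Z i \<omega>)\<^sup>2 + (Z j \<omega>)\<^sup>2)"
        using sum_squares_bound[of "\<bar>Z i \<omega>\<bar>" "\<bar>Z j \<omega>\<bar>"]
          mult_nonneg_nonneg[OF abs_ge_zero[of "Z i \<omega>"] abs_ge_zero[of "Z j \<omega>"]]
        unfolding real_norm_def abs_mult power2_abs by linarith
    qed
  qed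
  have int1: "integrable M (Z i)" if "i \<in> F" for i using int[OF that, of 1] by simp
  show "(LINT \<omega>|M. (\<Sum>i\<in>F. a i * Z i \<omega>)) = 0"
    using F int1 mean by (subst Bochner_Integration.integral_sum) (auto simp: subset_eq)
  have "(\<Sum>i\<in>F. a i * Z i \<omega>)\<^sup>2 = (\<Sum>i\<in>F. \<Sum>j\<in>F. a i * a j * (Z i \<omega> * Z j \<omega>))" for \<omega>
    unfolding power2_eq_square sum_product by (simp add: mult.assoc mult.left_commute)
  then have "(LINT \<omega>|M. (\<Sum>i\<in>F. a i * Z i \<omega>)\<^sup>2)
      = (\<Sum>i\<in>F. \<Sum>j\<in>F. a i * a j * (LINT \<omega>|M. Z i \<omega> * Z j \<omega>))"
    by (simp add: Bochner_Integration.integral_sum int2)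
  also have "\<dots> = (\<Sum>i\<in>F. \<Sum>j\<in>F. a i * a j * k i j)"
  proof (intro sum.cong refl)
    fix i j assume "i \<in> F" "j \<in> F"
    then have "i \<in> I" "j \<in> I" using F by auto
    then show "a i * a j * (LINT \<omega>|M. Z i \<omega> * Z j \<omega>) = a i * a j * k i j"
      using cov[of i j] mean[of i] mean[of j] by (simp add: covar_def)
  qed
  finally show "(LINT \<omega>|M. (\<Sum>i\<in>F. a i * Z i \<omega>)\<^sup>2) = (\<Sum>i\<in>F. \<Sum>j\<in>F. a i * a j * k i j)" .
qed

lemma gaussian_rv_nn_moments:
  assumes "prob_space M" and "gaussian_rv M Z" and "(LINT \<omega>|M. Z \<omega>) = 0"
  shows "(\<integral>\<^sup>+\<omega>. ennreal (\<bar>Z \<omega>\<bar> ^ (2 * m)) \<partial>M)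
    = ennreal (fact (2 * m) / (2 ^ m * fact m) * (LINT \<omega>|M. (Z \<omega>)\<^sup>2) ^ m)"
proof -
  have "(\<integral>\<^sup>+\<omega>. ennreal (\<bar>Z \<omega>\<bar> ^ (2 * m)) \<partial>M) = (\<integral>\<^sup>+\<omega>. ennreal (Z \<omega> ^ (2 * m)) \<partial>M)"
    by (simp add: power_even_abs)
  also have "\<dots> = ennreal (LINT \<omega>|M. Z \<omega> ^ (2 * m))"
    by (intro nn_integral_eq_integral gaussian_rv_moments(1)[OF assms(1,2)]) auto
  finally show ?thesis using gaussian_rv_moments(2)[OF assms] by simp
qed

text \<open>Every even moment of a centered Gaussian is a monotone function of its variance, so a
  uniform bound on variances is enough.\<close>

lemma gaussian_bounded_moments:
  assumes "prob_space M" and "\<And>i. i \<in> I \<Longrightarrow> gaussian_rv M (Z i)"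
    and "\<And>i. i \<in> I \<Longrightarrow> (LINT \<omega>|M. Z i \<omega>) = 0"
    and "\<And>i. i \<in> I \<Longrightarrow> (LINT \<omega>|M. (Z i \<omega>)\<^sup>2) \<le> C"
  shows "bounded_moments M I Z"
proof (rule bounded_moments_cofinal)
  fix m :: nat
  have "(\<integral>\<^sup>+\<omega>. ennreal (\<bar>Z i \<omega>\<bar> ^ (2*m)) \<partial>M) \<le> ennreal (fact (2 * m) / (2 ^ m * fact m) * C ^ m)"
    if "i \<in> I" for i
    unfolding gaussian_rv_nn_moments[OF assms(1) assms(2,3)[OF that]] using assms(4)[OF that]
    by (intro ennreal_leI mult_left_mono power_mono) auto
  then show "\<exists>p\<ge>m. \<exists>B::real. \<forall>i\<in>I. (\<integral>\<^sup>+\<omega>. ennreal (\<bar>Z i \<omega>\<bar> ^ p) \<partial>M) \<le> ennreal B"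
    by (intro exI[of _ "2*m"]) auto
qed (use assms in \<open>auto simp: gaussian_rv_def\<close>)

section \<open>Dyadic slopes\<close>

definition dyadic_slope :: "(real \<Rightarrow> real) \<Rightarrow> nat \<Rightarrow> int \<Rightarrow> real" where
  "dyadic_slope f n k = 2 ^ n * (f ((of_int k + 1) / 2 ^ n) - f (of_int k / 2 ^ n))"

definition dyadic_kink :: "(real \<Rightarrow> real) \<Rightarrow> nat \<Rightarrow> int \<Rightarrow> real" where
  "dyadic_kink f n k = dyadic_slope f n (k + 1) - dyadic_slope f n k"

text \<open>The ratio 4/5 is one choice strictly between 1 / sqrt 2 and 1. Kinks at level
  \<open>n\<close> have standard deviation of order 2^(-n/2), so a ratio above 1 / sqrt 2 leaves
  room for summing over levels, and a ratio below 1 makes the chaining converge. The last factor is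
  1 + |x| at the left end x of the first interval.\<close>

definition kink_bounded :: "(real \<Rightarrow> real) \<Rightarrow> real \<Rightarrow> bool" where
  "kink_bounded f G \<longleftrightarrow>
     (\<forall>n k. \<bar>dyadic_kink f n k\<bar> \<le> G * (4 / 5) ^ n * (1 + \<bar>of_int k\<bar> / 2 ^ n))"

lemma dyadic_slope_refine:
  "dyadic_slope f n k = (dyadic_slope f (Suc n) (2 * k) + dyadic_slope f (Suc n) (2 * k + 1)) / 2"
proof -
  define a m b :: real where "a = of_int k / 2 ^ n" and "m = (2 * of_int k + 1) / 2 ^ Suc n"
    and "b = (of_int k + 1) / 2 ^ n"
  have "of_int (2 * k) / 2 ^ Suc n = a" "(of_int (2 * k) + 1) / 2 ^ Suc n = m"
    "of_int (2 * k + 1) / 2 ^ Suc n = m" "(of_int (2 * k + 1) + 1) / 2 ^ Suc n = b"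
    by (simp_all add: a_def m_def b_def field_simps)
  then show ?thesis
    unfolding dyadic_slope_def by (simp only: a_def[symmetric] b_def[symmetric]) (simp add: algebra_simps)
qed

lemma floor_double_cases:
  fixes x :: real
  shows "\<lfloor>2 * x\<rfloor> = 2 * \<lfloor>x\<rfloor> \<or> \<lfloor>2 * x\<rfloor> = 2 * \<lfloor>x\<rfloor> + 1"
  by linarith

text \<open>The finer interval around \<open>x\<close> is the left or the right half of the coarser
  one, whose slope is the mean of the two half slopes. In both cases the change is half of the kink
  between the halves.\<close>

lemma dyadic_slope_step:
  fixes x :: real
  shows "\<bar>dyadic_slope f (Suc n) \<lfloor>x * 2 ^ Suc n\<rfloor> - dyadic_slope f n \<lfloor>x * 2 ^ n\<rfloor>\<bar>
     = \<bar>dyadic_kink f (Suc n) (2 * \<lfloor>x * 2 ^ n\<rfloor>)\<bar> / 2"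
proof -
  have "x * 2 ^ Suc n = 2 * (x * 2 ^ n)" by simp
  then have "\<lfloor>x * 2 ^ Suc n\<rfloor> = 2 * \<lfloor>x * 2 ^ n\<rfloor> \<or> \<lfloor>x * 2 ^ Suc n\<rfloor> = 2 * \<lfloor>x * 2 ^ n\<rfloor> + 1"
    using floor_double_cases[of "x * 2 ^ n"] by (simp only:)
  moreover have "\<bar>p - (p + q) / 2\<bar> = \<bar>q - p\<bar> / 2" "\<bar>q - (p + q) / 2\<bar> = \<bar>q - p\<bar> / 2" for p q :: real
    by (auto simp: abs_if field_simps)
  ultimately show ?thesis
    unfolding dyadic_kink_def dyadic_slope_refine[of f n "\<lfloor>x * 2 ^ n\<rfloor>"] by metis
qed

lemma floor_dyadic_bound:
  fixes x :: real
  shows "\<bar>real_of_int \<lfloor>x * 2 ^ n\<rfloor>\<bar> / 2 ^ n \<le> \<bar>x\<bar> + 1"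
proof -
  have "\<bar>real_of_int \<lfloor>x * 2 ^ n\<rfloor>\<bar> \<le> \<bar>x * 2 ^ n\<bar> + 1" by linarith
  also have "\<dots> \<le> (\<bar>x\<bar> + 1) * 2 ^ n"
    by (simp add: abs_mult algebra_simps)
  finally show ?thesis by (simp add: divide_le_eq)
qed

lemma kink_bounded_nonneg:
  assumes "kink_bounded f G" shows "G \<ge> 0"
  using assms[unfolded kink_bounded_def, rule_format, of 0 0] by (auto intro: order_trans[OF abs_ge_zero])

text \<open>The cost of one step, half a weighted kink, equals
  \<open>2 * G * (2 + \<bar>x\<bar>)\<close> times the drop of (4/5)^n to the next level. The
  right-hand side is written as a difference so that it telescopes and stays bounded in
  \<open>j\<close>.\<close>

lemma dyadic_slope_diff_bound:
  assumes "kink_bounded f G"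
  shows "\<bar>dyadic_slope f (n + j) \<lfloor>x * 2 ^ (n + j)\<rfloor> - dyadic_slope f n \<lfloor>x * 2 ^ n\<rfloor>\<bar>
    \<le> 2 * G * (2 + \<bar>x\<bar>) * ((4 / 5) ^ n - (4 / 5) ^ (n + j))"
proof (induction j)
  case 0
  then show ?case by simp
next
  case (Suc j)
  let ?A = "\<lambda>m. dyadic_slope f m \<lfloor>x * 2 ^ m\<rfloor>" and ?N = "n + j"
  have G: "G \<ge> 0" by (rule kink_bounded_nonneg[OF assms])
  have "\<bar>?A (Suc ?N) - ?A ?N\<bar> = \<bar>dyadic_kink f (Suc ?N) (2 * \<lfloor>x * 2 ^ ?N\<rfloor>)\<bar> / 2"
    by (rule dyadic_slope_step)
  also have "\<dots> \<le> G * (4 / 5) ^ Suc ?N * (1 + \<bar>of_int (2 * \<lfloor>x * 2 ^ ?N\<rfloor>)\<bar> / 2 ^ Suc ?N) / 2"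
    by (rule divide_right_mono[OF assms[unfolded kink_bounded_def, rule_format]]) simp
  also have "\<bar>of_int (2 * \<lfloor>x * 2 ^ ?N\<rfloor>)\<bar> / 2 ^ Suc ?N = \<bar>real_of_int \<lfloor>x * 2 ^ ?N\<rfloor>\<bar> / 2 ^ ?N"
    by (simp add: abs_mult)
  also have "G * (4 / 5) ^ Suc ?N * (1 + \<bar>real_of_int \<lfloor>x * 2 ^ ?N\<rfloor>\<bar> / 2 ^ ?N) / 2
      \<le> G * (4 / 5) ^ Suc ?N * (2 + \<bar>x\<bar>) / 2"
    using G floor_dyadic_bound[of x ?N] by (intro divide_right_mono mult_left_mono) auto
  also have "\<dots> = 2 * G * (2 + \<bar>x\<bar>) * ((4 / 5) ^ ?N - (4 / 5) ^ Suc ?N)"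
    by (simp add: algebra_simps)
  finally have "\<bar>?A (Suc ?N) - ?A ?N\<bar> \<le> 2 * G * (2 + \<bar>x\<bar>) * ((4 / 5) ^ ?N - (4 / 5) ^ Suc ?N)" .
  then have "\<bar>?A (Suc ?N) - ?A n\<bar> \<le> 2 * G * (2 + \<bar>x\<bar>) * ((4 / 5) ^ ?N - (4 / 5) ^ Suc ?N)
      + 2 * G * (2 + \<bar>x\<bar>) * ((4 / 5) ^ n - (4 / 5) ^ ?N)"
    using Suc.IH by linarith
  also have "\<dots> = 2 * G * (2 + \<bar>x\<bar>) * ((4 / 5) ^ n - (4 / 5) ^ Suc ?N)"
    by (simp only: algebra_simps)
  finally show ?case by simp
qed

text \<open>The dyadic interval contains \<open>x\<close>, so differentiability at the single point \<open>x\<close> is enough.\<close>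

lemma dyadic_slope_tendsto_deriv:
  assumes "f differentiable (at x)"
  shows "(\<lambda>n. dyadic_slope f n \<lfloor>x * 2 ^ n\<rfloor>) \<longlonglongrightarrow> deriv f x"
proof (rule LIMSEQ_I)
  fix e :: real assume e: "e > 0"
  let ?D = "deriv f x"
  have "(f has_real_derivative ?D) (at x)"
    using assms DERIV_deriv_iff_real_differentiable by blast
  then have "(f has_derivative (*) ?D) (at x)" by (simp add: has_field_derivative_def)
  then obtain d where d: "d > 0"
    and f: "\<And>y. norm (y - x) < d \<Longrightarrow> norm (f y - f x - ?D * (y - x)) \<le> e / 2 * norm (y - x)"
    unfolding has_derivative_at_alt using e by (meson half_gt_zero)
  obtain N where N: "(1 / 2) ^ N < d"
    using real_arch_pow_inv[of d "1 / 2"] d by auto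
  show "\<exists>N. \<forall>n\<ge>N. norm (dyadic_slope f n \<lfloor>x * 2 ^ n\<rfloor> - ?D) < e"
  proof (intro exI[of _ N] allI impI)
    fix n assume "N \<le> n"
    then have "(1 / 2 :: real) ^ n \<le> (1 / 2) ^ N" by (intro power_decreasing) auto
    then have n: "(1 / 2) ^ n < d" using N by (rule order.strict_trans1)
    define u v where "u = of_int \<lfloor>x * 2 ^ n\<rfloor> / (2::real) ^ n" and "v = (of_int \<lfloor>x * 2 ^ n\<rfloor> + 1) / (2::real) ^ n"
    have uv: "v - u = (1 / 2) ^ n" by (simp add: u_def v_def field_simps)
    have ux: "u \<le> x" unfolding u_def by (simp add: divide_le_eq)
    have xv: "x \<le> v" unfolding v_def by (simp add: le_divide_eq)
    have 1: "\<bar>f v - f x - ?D * (v - x)\<bar> \<le> e / 2 * (v - x)"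
      using f[of v] uv ux xv n by simp
    have 2: "\<bar>f u - f x - ?D * (u - x)\<bar> \<le> e / 2 * (x - u)"
      using f[of u] uv ux xv n by simp
    have "\<bar>f v - f u - ?D * (v - u)\<bar> \<le> e / 2 * (v - x) + e / 2 * (x - u)"
    proof -
      have "f v - f u - ?D * (v - u) = (f v - f x - ?D * (v - x)) - (f u - f x - ?D * (u - x))"
        by (simp add: algebra_simps)
      then show ?thesis using 1 2 by linarith
    qed
    also have "\<dots> = e / 2 * (v - u)" by (simp flip: distrib_left)
    finally have "2 ^ n * \<bar>f v - f u - ?D * (v - u)\<bar> \<le> 2 ^ n * (e / 2 * (v - u))"
      by (intro mult_left_mono) auto
    moreover have "2 ^ n * (e / 2 * (v - u)) = e / 2"
      unfolding uv by (simp add: power_divide)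
    moreover have "dyadic_slope f n \<lfloor>x * 2 ^ n\<rfloor> - ?D = 2 ^ n * (f v - f u - ?D * (v - u))"
    proof -
      have "2 ^ n * (v - u) = 1" unfolding uv by (simp add: power_divide)
      then have "?D * (2 ^ n * (v - u)) = ?D" by simp
      then show ?thesis
        unfolding dyadic_slope_def u_def[symmetric] v_def[symmetric] by (simp add: algebra_simps)
    qed
    ultimately have "norm (dyadic_slope f n \<lfloor>x * 2 ^ n\<rfloor> - ?D) \<le> e / 2"
      by (simp only: real_norm_def abs_mult power_abs abs_numeral)
    then show "norm (dyadic_slope f n \<lfloor>x * 2 ^ n\<rfloor> - ?D) < e"
      using e by linarith
  qed
qed

section \<open>Rate of convergence, modulus of continuity and growth of the derivative\<close>

lemma deriv_dyadic_slope_bound: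
  assumes "kink_bounded f G" and "f differentiable (at x)"
  shows "\<bar>deriv f x - dyadic_slope f n \<lfloor>x * 2 ^ n\<rfloor>\<bar> \<le> 2 * G * (2 + \<bar>x\<bar>) * (4 / 5) ^ n"
proof (rule LIMSEQ_le_const2)
  let ?A = "\<lambda>m. dyadic_slope f m \<lfloor>x * 2 ^ m\<rfloor>"
  have "(\<lambda>j. ?A (j + n)) \<longlonglongrightarrow> deriv f x"
    by (rule LIMSEQ_ignore_initial_segment[OF dyadic_slope_tendsto_deriv[OF assms(2)]])
  then show "(\<lambda>j. \<bar>?A (n + j) - ?A n\<bar>) \<longlonglongrightarrow> \<bar>deriv f x - ?A n\<bar>"
    by (intro tendsto_intros) (simp add: add.commute)
  have "\<bar>?A (n + j) - ?A n\<bar> \<le> 2 * G * (2 + \<bar>x\<bar>) * (4 / 5) ^ n" for j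
    using kink_bounded_nonneg[OF assms(1)]
    by (intro order_trans[OF dyadic_slope_diff_bound[OF assms(1)]] mult_left_mono) auto
  then show "\<exists>N. \<forall>j\<ge>N. \<bar>?A (n + j) - ?A n\<bar> \<le> 2 * G * (2 + \<bar>x\<bar>) * (4 / 5) ^ n" by blast
qed

text \<open>At distance at most 2^(-n) the two points lie in the same or in adjacent dyadic
  intervals of level \<open>n\<close>, so the slopes differ by at most one kink. Together with the
  two approximation errors this gives 5 = 1 + 2 + 2. In terms of the distance it is a Hoelder bound
  with exponent log 5/4 to the base 2.\<close>

lemma kink_bounded_deriv_diff:
  assumes kb: "kink_bounded f G" and diff: "\<And>x. f differentiable (at x)"
    and xy: "\<bar>x - y\<bar> \<le> 1 / 2 ^ n"
  shows "\<bar>deriv f x - deriv f y\<bar> \<le> 5 * G * (2 + \<bar>x\<bar> + \<bar>y\<bar>) * (4 / 5) ^ n"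
  using xy
proof (induction x y rule: linorder_wlog)
  case (sym a b)
  then show ?case by (simp add: abs_minus_commute add.commute add.left_commute)
next
  case (le x y)
  let ?A = "\<lambda>z. dyadic_slope f n \<lfloor>z * 2 ^ n\<rfloor>" and ?r = "(4 / 5 :: real) ^ n"
  have G: "G \<ge> 0" by (rule kink_bounded_nonneg[OF kb])
  have "y - x \<le> 1 / 2 ^ n" using le by simp
  then have "(y - x) * 2 ^ n \<le> 1" by (simp add: field_simps)
  moreover have "x * 2 ^ n \<le> y * 2 ^ n" using le by simp
  ultimately have "\<lfloor>y * 2 ^ n\<rfloor> = \<lfloor>x * 2 ^ n\<rfloor> \<or> \<lfloor>y * 2 ^ n\<rfloor> = \<lfloor>x * 2 ^ n\<rfloor> + 1"
    unfolding left_diff_distrib by linarith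
  then have "\<bar>?A y - ?A x\<bar> \<le> \<bar>dyadic_kink f n \<lfloor>x * 2 ^ n\<rfloor>\<bar>"
    unfolding dyadic_kink_def by auto
  also have "\<dots> \<le> G * ?r * (1 + \<bar>of_int \<lfloor>x * 2 ^ n\<rfloor>\<bar> / 2 ^ n)"
    using kb unfolding kink_bounded_def by blast
  also have "\<dots> \<le> G * ?r * (2 + \<bar>x\<bar>)"
    using G floor_dyadic_bound[of x n] by (intro mult_left_mono) auto
  finally have "\<bar>deriv f x - deriv f y\<bar> \<le> G * ?r * (2 + \<bar>x\<bar>)
      + 2 * G * (2 + \<bar>x\<bar>) * ?r + 2 * G * (2 + \<bar>y\<bar>) * ?r"
    using deriv_dyadic_slope_bound[OF kb diff, of x n] deriv_dyadic_slope_bound[OF kb diff, of y n]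
    by linarith
  also have "\<dots> = (G * ?r) * (3 * (2 + \<bar>x\<bar>) + 2 * (2 + \<bar>y\<bar>))"
    by (simp add: algebra_simps)
  also have "\<dots> \<le> (G * ?r) * (5 * (2 + \<bar>x\<bar> + \<bar>y\<bar>))"
    using G by (intro mult_left_mono) auto
  finally show ?case by (simp add: mult_ac)
qed

text \<open>Walking from 0 to \<open>x\<close> in unit steps costs a linear amount per step, hence a
  quadratic total. In 14 = 4 + 10 the 4 compares \<open>deriv f 0\<close> with the slope over
  [0, 1], and the 10 comes from the walk.\<close>

lemma kink_bounded_deriv_growth:
  assumes kb: "kink_bounded f G" and diff: "\<And>x. f differentiable (at x)"
  shows "\<bar>deriv f x\<bar> \<le> (\<bar>dyadic_slope f 0 0\<bar> + 14 * G) * (2 + \<bar>x\<bar>)\<^sup>2"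
proof -
  have G: "G \<ge> 0" by (rule kink_bounded_nonneg[OF kb])
  have grow: "\<bar>deriv f x\<bar> \<le> \<bar>deriv f 0\<bar> + real N * (5 * G * (2 + 2 * real N))" if "\<bar>x\<bar> \<le> real N" for x N
    using that
  proof (induction N arbitrary: x)
    case 0
    then show ?case by simp
  next
    case (Suc N)
    \<comment> \<open>One step towards 0, stopping at 0; the modulus is applied at level 0, which
      covers distances up to 1.\<close>
    define y where "y = (if x > 1 then x - 1 else if x < -1 then x + 1 else 0)"
    have y: "\<bar>y\<bar> \<le> real N" "\<bar>x - y\<bar> \<le> 1" using Suc.prems by (auto simp: y_def)
    have "\<bar>deriv f x - deriv f y\<bar> \<le> 5 * G * (2 + \<bar>x\<bar> + \<bar>y\<bar>)"
      using kink_bounded_deriv_diff[OF kb diff, of x y 0] y by simp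
    also have "\<dots> \<le> 5 * G * (2 + 2 * real (Suc N))"
      using G y Suc.prems by (intro mult_left_mono) auto
    finally have "\<bar>deriv f x - deriv f y\<bar> \<le> 5 * G * (2 + 2 * real (Suc N))" .
    moreover have "\<bar>deriv f y\<bar> \<le> \<bar>deriv f 0\<bar> + real N * (5 * G * (2 + 2 * real (Suc N)))"
      using Suc.IH[OF y(1)] G
      by (elim order_trans) (intro add_left_mono mult_left_mono, auto)
    ultimately show ?case by (simp add: algebra_simps)
  qed
  define w where "w = 2 + \<bar>x\<bar>"
  define N where "N = nat \<lceil>\<bar>x\<bar>\<rceil>"
  have N: "\<bar>x\<bar> \<le> real N" "real N \<le> \<bar>x\<bar> + 1" unfolding N_def by linarith+
  have "\<bar>deriv f x\<bar> \<le> \<bar>deriv f 0\<bar> + real N * (5 * G * (2 + 2 * real N))" by (rule grow[OF N(1)])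
  also have "real N * (5 * G * (2 + 2 * real N)) \<le> (2 + \<bar>x\<bar>) * (5 * G * (2 * (2 + \<bar>x\<bar>)))"
    using N G by (intro mult_mono mult_left_mono) auto
  also have "\<bar>deriv f 0\<bar> \<le> \<bar>dyadic_slope f 0 0\<bar> + 4 * G"
    using deriv_dyadic_slope_bound[OF kb diff, of 0 0] by simp
  also have "\<bar>dyadic_slope f 0 0\<bar> + 4 * G \<le> (\<bar>dyadic_slope f 0 0\<bar> + 4 * G) * (2 + \<bar>x\<bar>)\<^sup>2"
    using G by (intro mult_le_cancel_left1[THEN iffD2]) (auto intro!: one_le_power)
  finally show ?thesis
    unfolding w_def[symmetric] by (simp add: algebra_simps power2_eq_square)
qed

section \<open>Kinks of the potential\<close>

text \<open>For a process with covariance \<open>c\<close> this is the second moment of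
  \<open>V (x + 2 h) - 2 V (x + h) + V x\<close>.\<close>

definition double_second_difference :: "(real \<Rightarrow> real \<Rightarrow> real) \<Rightarrow> real \<Rightarrow> real \<Rightarrow> real" where
  "double_second_difference c x h =
    c (x + 2*h) (x + 2*h) + 4 * c (x + h) (x + h) + c x x
    - 2 * c (x + 2*h) (x + h) - 2 * c (x + h) (x + 2*h)
    + c (x + 2*h) x + c x (x + 2*h) - 2 * c (x + h) x - 2 * c x (x + h)"

text \<open>The expression is the signed sum of four rectangular increments of \<open>c\<close> over
  squares of side \<open>h\<close>. Each is \<open>h\<^sup>2\<close> times the mixed derivative at
  some point of its square. The signs cancel in pairs, so the Lipschitz condition gains one more
  factor \<open>h\<close>.\<close>

lemma second_difference_bound:
  assumes "C2_lipschitz_mixed c"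
  obtains L where "L \<ge> 0" "\<And>x h. h > 0 \<Longrightarrow> double_second_difference c x h \<le> L * h ^ 3"
proof -
  obtain c1 c12 where d1: "\<And>x y. ((\<lambda>u. c u y) has_real_derivative c1 x y) (at x)"
    and d12: "\<And>x y. ((\<lambda>v. c1 x v) has_real_derivative c12 x y) (at y)"
    and lip: "\<exists>L. L-lipschitz_on UNIV (\<lambda>(x, y). c12 x y)"
    using assms unfolding C2_lipschitz_mixed_def by (elim exE conjE) (blast elim: ballE)
  obtain L where L: "L-lipschitz_on UNIV (\<lambda>(x, y). c12 x y)" using lip by blast
  have L0: "L \<ge> 0" by (rule lipschitz_on_nonneg[OF L])
  show thesis
  proof (rule that[of "8 * L"])
    show "0 \<le> 8 * L" using L0 by simp
    fix x h :: real assume h: "h > 0"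
    define f where "f u v = c (u + h) (v + h) - c (u + h) v - c u (v + h) + c u v" for u v
    \<comment> \<open>Mean value theorem in the first argument for the increment in the second,
      followed by the mean value theorem in the second argument for \<open>c1 \<xi>\<close>.\<close>
    have mv: "\<exists>\<xi> \<eta>. u < \<xi> \<and> \<xi> < u + h \<and> v < \<eta> \<and> \<eta> < v + h \<and> f u v = h\<^sup>2 * c12 \<xi> \<eta>" for u v
    proof -
      have "\<exists>\<xi>. u < \<xi> \<and> \<xi> < u + h \<and> (c (u + h) (v + h) - c (u + h) v) - (c u (v + h) - c u v)
          = (u + h - u) * (c1 \<xi> (v + h) - c1 \<xi> v)"
        using h by (intro MVT2) (auto intro!: DERIV_diff d1)
      then obtain \<xi> where \<xi>: "u < \<xi>" "\<xi> < u + h" "f u v = h * (c1 \<xi> (v + h) - c1 \<xi> v)"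
        by (auto simp: f_def algebra_simps)
      have "\<exists>\<eta>. v < \<eta> \<and> \<eta> < v + h \<and> c1 \<xi> (v + h) - c1 \<xi> v = (v + h - v) * c12 \<xi> \<eta>"
        using h by (intro MVT2) (auto intro!: d12)
      with \<xi> show ?thesis by (auto simp: power2_eq_square mult.assoc)
    qed
    \<comment> \<open>Both intermediate points lie in the square over \<open>[x, x + 2 * h]\<close>:
      each coordinate differs by at most \<open>2 * h\<close>, which gives \<open>4 * h\<close> in
      total.\<close>
    have near: "f u v - f u' v' \<le> 4 * L * h ^ 3"
      if "u \<in> {x, x + h}" "v \<in> {x, x + h}" "u' \<in> {x, x + h}" "v' \<in> {x, x + h}" for u v u' v'
    proof -
      obtain \<xi> \<eta> where 1: "u < \<xi>" "\<xi> < u + h" "v < \<eta>" "\<eta> < v + h" "f u v = h\<^sup>2 * c12 \<xi> \<eta>"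
        using mv by blast
      obtain \<xi>' \<eta>' where 2: "u' < \<xi>'" "\<xi>' < u' + h" "v' < \<eta>'" "\<eta>' < v' + h" "f u' v' = h\<^sup>2 * c12 \<xi>' \<eta>'"
        using mv by blast
      have "c12 \<xi> \<eta> - c12 \<xi>' \<eta>' \<le> L * dist (\<xi>, \<eta>) (\<xi>', \<eta>')"
        using lipschitz_onD[OF L, of "(\<xi>, \<eta>)" "(\<xi>', \<eta>')"] by (simp add: dist_real_def)
      also have "\<dots> \<le> L * (4 * h)"
      proof (intro mult_left_mono L0)
        have "dist (\<xi>, \<eta>) (\<xi>', \<eta>') \<le> \<bar>\<xi> - \<xi>'\<bar> + \<bar>\<eta> - \<eta>'\<bar>"
          unfolding dist_Pair_Pair dist_real_def
          using sqrt_sum_squares_le_sum_abs[of "\<xi> - \<xi>'" "\<eta> - \<eta>'"] by simp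
        also have "\<dots> \<le> 4 * h" using 1 2 that h by auto
        finally show "dist (\<xi>, \<eta>) (\<xi>', \<eta>') \<le> 4 * h" .
      qed
      finally have "h\<^sup>2 * (c12 \<xi> \<eta> - c12 \<xi>' \<eta>') \<le> h\<^sup>2 * (L * (4 * h))"
        by (intro mult_left_mono) auto
      then show ?thesis unfolding 1 2 by (simp add: algebra_simps power2_eq_square power3_eq_cube)
    qed
    have "(f (x + h) (x + h) - f (x + h) x) + (f x x - f x (x + h)) \<le> 4 * L * h ^ 3 + 4 * L * h ^ 3"
      by (intro add_mono near) auto
    moreover have [simp]: "x + h + h = x + 2 * h" by simp
    ultimately show "double_second_difference c x h \<le> 8 * L * h ^ 3"
      unfolding f_def double_second_difference_def by simp
  qed
qed

text \<open>With \<open>h\<close> = 2^(-n) the kink is (V(x + 2h) - 2 V(x + h) + V(x)) / h at three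
  distinct points. Dividing the bound \<open>L * h ^ 3\<close> by \<open>h\<^sup>2\<close> leaves
  \<open>L * h\<close>.\<close>

lemma dyadic_kink_gaussian:
  assumes "prob_space M" and cg: "centered_gaussian_process M UNIV V c"
    and L: "\<And>x h. h > 0 \<Longrightarrow> double_second_difference c x h \<le> L * h ^ 3"
  defines "Z \<equiv> \<lambda>n k \<omega>. dyadic_kink (\<lambda>x. V x \<omega>) n k"
  shows "gaussian_rv M (Z n k)" and "(LINT \<omega>|M. Z n k \<omega>) = 0"
    and "(LINT \<omega>|M. (Z n k \<omega>)\<^sup>2) \<le> L * (1 / 2) ^ n"
proof -
  define h where "h = (1 / 2 :: real) ^ n"
  define x where "x = of_int k * h"
  define F where "F = {x, x + h, x + 2 * h}"
  define a where "a z = (if z = x + h then - 2 / h else 1 / h)" for z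
  have h: "h > 0" by (simp add: h_def)
  have fin: "finite F" by (simp add: F_def)
  have "Z n k \<omega> = (\<Sum>i\<in>F. a i * V i \<omega>)" for \<omega>
  proof -
    have "(of_int k + 1) / 2 ^ n = x + h" "of_int k / 2 ^ n = x"
      "(of_int (k + 1) + 1) / 2 ^ n = x + 2 * h" "of_int (k + 1) / 2 ^ n = x + h" "2 ^ n = 1 / h"
      by (simp_all add: x_def h_def power_divide field_simps)
    then have "Z n k \<omega> = (V (x + 2 * h) \<omega> - V (x + h) \<omega>) / h - (V (x + h) \<omega> - V x \<omega>) / h"
      unfolding Z_def dyadic_kink_def dyadic_slope_def by simp
    then show ?thesis using h by (simp add: F_def a_def diff_divide_distrib)
  qed
  then have Z: "Z n k = (\<lambda>\<omega>. \<Sum>i\<in>F. a i * V i \<omega>)" by auto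
  note sums = centered_gaussian_process_sum[OF assms(1) cg fin subset_UNIV, of a]
  show "gaussian_rv M (Z n k)" "(LINT \<omega>|M. Z n k \<omega>) = 0" unfolding Z by (rule sums)+
  have "(LINT \<omega>|M. (Z n k \<omega>)\<^sup>2) = (\<Sum>i\<in>F. \<Sum>j\<in>F. a i * a j * c i j)"
    unfolding Z by (rule sums)
  also have "\<dots> = double_second_difference c x h / h\<^sup>2"
    using h by (simp add: F_def a_def double_second_difference_def) (simp add: field_simps power2_eq_square)
  also have "\<dots> \<le> (L * h ^ 3) / h\<^sup>2"
    by (intro divide_right_mono L[OF h]) simp
  also have "\<dots> = L * (1 / 2) ^ n" using h by (simp add: h_def[symmetric] power2_eq_square power3_eq_cube)
  finally show "(LINT \<omega>|M. (Z n k \<omega>)\<^sup>2) \<le> L * (1 / 2) ^ n" .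
qed

section \<open>Summation of the kinks over all levels and positions\<close>

lemma int_decode_bound: "real j + 1 \<le> 2 * (1 + \<bar>real_of_int (int_decode j)\<bar>)"
proof -
  \<comment> \<open>Nonnegative \<open>k\<close> have the even code 2k, negative \<open>k\<close>
    the odd code 2|k| - 1.\<close>
  have "int_encode k \<le> 2 * nat \<bar>k\<bar>" for k
    by (auto simp: int_encode_def sum_encode_def)
  from this[of "int_decode j"] have "int j \<le> 2 * \<bar>int_decode j\<bar>" by simp
  then have "real_of_int (int j) \<le> of_int (2 * \<bar>int_decode j\<bar>)" by (simp only: of_int_le_iff)
  then show ?thesis by simp
qed

text \<open>The weight is at most 1, so two of its \<open>2 * m\<close> powers may be kept and the
  others dropped. Two powers decay like the inverse square of the position and hence of its code
  \<open>j\<close>, which makes the sum over positions finite, at the price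
  \<open>4 ^ n\<close>.\<close>

lemma kink_weight_bound:
  assumes "m \<ge> 1"
  shows "(1 / (1 + \<bar>real_of_int (int_decode j)\<bar> / 2 ^ n)) ^ (2 * m) \<le> 4 ^ n * (4 / (real j + 1)\<^sup>2)"
proof -
  let ?k = "\<bar>real_of_int (int_decode j)\<bar>" let ?w = "1 / (1 + ?k / 2 ^ n)"
  have w: "0 \<le> ?w" "?w \<le> 1" by (auto intro!: add_nonneg_nonneg simp: divide_le_eq_1)
  have "?w ^ (2 * m) \<le> ?w\<^sup>2"
    using w assms by (intro power_decreasing) auto
  also have "?w \<le> 2 ^ n * (2 / (real j + 1))"
  proof -
    have "?w = 2 ^ n / (2 ^ n + ?k)" by (simp add: field_simps)
    also have "\<dots> \<le> 2 ^ n / ((real j + 1) / 2)"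
    proof (intro divide_left_mono)
      have "(real j + 1) / 2 \<le> 1 + ?k" using int_decode_bound[of j] by simp
      then show "(real j + 1) / 2 \<le> 2 ^ n + ?k" by (rule order_trans) simp
    qed (auto intro!: mult_pos_pos intro: add_pos_nonneg add_nonneg_pos)
    finally show ?thesis by simp
  qed
  then have "?w\<^sup>2 \<le> (2 ^ n * (2 / (real j + 1)))\<^sup>2"
    using w by (intro power_mono) auto
  also have "\<dots> = 4 ^ n * (4 / (real j + 1)\<^sup>2)"
    by (simp add: power_mult_distrib power_divide power2_eq_square flip: power_mult_distrib)
  finally show ?thesis .
qed

lemma potential_kink_bounded:
  assumes "prob_space M" and cg: "centered_gaussian_process M UNIV V c" and "C2_lipschitz_mixed c"
  obtains G where "bounded_moments M (UNIV :: unit set) (\<lambda>_. G)"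
    and "AE \<omega> in M. kink_bounded (\<lambda>x. V x \<omega>) (G \<omega>)"
proof -
  interpret prob_space M by fact
  obtain L where L0: "L \<ge> 0" and L: "\<And>x h. h > 0 \<Longrightarrow> double_second_difference c x h \<le> L * h ^ 3"
    using second_difference_bound[OF assms(3)] by blast
  define Z where "Z n j \<omega> = dyadic_kink (\<lambda>x. V x \<omega>) n (int_decode j)" for n j \<omega>
  define w where "w n j = 1 / (1 + \<bar>real_of_int (int_decode j)\<bar> / 2 ^ n)" for n :: nat and j
  define A where "A n j \<omega> = \<bar>Z n j \<omega>\<bar> * ((5 / 4) ^ n * w n j)" for n j \<omega>
  note gauss = dyadic_kink_gaussian[OF assms(1) cg L, of _ "int_decode _", folded Z_def]
  have [measurable]: "Z n j \<in> borel_measurable M" for n j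
    using gauss(1) by (auto simp: gaussian_rv_def)
  have [measurable]: "A n j \<in> borel_measurable M" for n j
    unfolding A_def by measurable
  have w0: "w n j > 0" for n j
    unfolding w_def by (intro divide_pos_pos add_pos_nonneg) auto
  have A0: "A n j \<omega> \<ge> 0" for n j \<omega>
    using w0[of n j] by (simp add: A_def)
  define T where "T p \<omega> = (\<Sum>n. \<Sum>j. ennreal (A n j \<omega> ^ p))" for p \<omega>
  have T_meas[measurable]: "T p \<in> borel_measurable M" for p
    unfolding T_def by measurable
  have T: "\<exists>B::real. (\<integral>\<^sup>+\<omega>. T (2 * m) \<omega> \<partial>M) \<le> ennreal B" if m: "m \<ge> 6" for m
  proof -
    define D where "D = fact (2 * m) / (2 ^ m * fact m) * L ^ m"
    \<comment> \<open>\<open>25 / 32 = (5 / 4)\<^sup>2 / 2\<close>: squared weight times decay of the variance; the factor \<open>4\<close> pays for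
      the number of positions at each level, and \<open>m \<ge> 6\<close> makes \<open>r < 1\<close>.\<close>
    define r where "r = (25 / 32 :: real) ^ m * 4"
    have D0: "D \<ge> 0" using L0 by (simp add: D_def)
    have r0: "r \<ge> 0" by (simp add: r_def)
    have "(25 / 32 :: real) ^ m \<le> (25 / 32) ^ 6" using m by (intro power_decreasing) auto
    then have r1: "r < 1" unfolding r_def by (rule le_less_trans[OF mult_right_mono]) (simp_all add: field_simps)
    have sw: "summable (\<lambda>j. 4 / (real j + 1)\<^sup>2)"
    proof -
      have "summable (\<lambda>j. inverse ((real (Suc j))\<^sup>2))"
        by (subst summable_Suc_iff) (rule inverse_power_summable, simp)
      from summable_mult[OF this, of 4] show ?thesis
        by (simp add: field_simps add.commute)
    qed
    define W where "W = (\<Sum>j. 4 / (real j + 1)\<^sup>2)"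
    have W0: "W \<ge> 0" unfolding W_def by (intro suminf_nonneg sw) auto
    have A_mom: "(\<integral>\<^sup>+\<omega>. ennreal (A n j \<omega> ^ (2 * m)) \<partial>M) \<le> ennreal (D * r ^ n * (4 / (real j + 1)\<^sup>2))" for n j
    proof -
      let ?s = "(5 / 4) ^ n * w n j"
      have "(\<integral>\<^sup>+\<omega>. ennreal (A n j \<omega> ^ (2 * m)) \<partial>M)
          = (\<integral>\<^sup>+\<omega>. ennreal (?s ^ (2 * m)) * ennreal (\<bar>Z n j \<omega>\<bar> ^ (2 * m)) \<partial>M)"
        using w0[of n j] unfolding A_def
        by (intro nn_integral_cong) (simp only: power_mult_distrib mult.commute flip: ennreal_mult', simp add: mult_ac flip: ennreal_mult)
      also have "\<dots> = ennreal (?s ^ (2 * m)) * (\<integral>\<^sup>+\<omega>. ennreal (\<bar>Z n j \<omega>\<bar> ^ (2 * m)) \<partial>M)"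
        by (intro nn_integral_cmult) measurable
      also have "\<dots> = ennreal (?s ^ (2 * m) * (fact (2 * m) / (2 ^ m * fact m) * (LINT \<omega>|M. (Z n j \<omega>)\<^sup>2) ^ m))"
        using w0[of n j]
        by (subst ennreal_mult'') (simp_all add: gaussian_rv_nn_moments[OF assms(1) gauss(1,2)])
      also have "\<dots> \<le> ennreal (D * r ^ n * (4 / (real j + 1)\<^sup>2))"
      proof (rule ennreal_leI)
        have "?s ^ (2 * m) * (fact (2 * m) / (2 ^ m * fact m) * (LINT \<omega>|M. (Z n j \<omega>)\<^sup>2) ^ m)
          \<le> ?s ^ (2 * m) * (fact (2 * m) / (2 ^ m * fact m) * (L * (1 / 2) ^ n) ^ m)"
          using w0[of n j] gauss(3)[of n j] by (intro mult_left_mono power_mono) auto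
        also have "\<dots> = D * (((5 / 4) ^ n) ^ (2 * m) * ((1 / 2) ^ n) ^ m) * w n j ^ (2 * m)"
          by (simp only: D_def power_mult_distrib mult_ac)
        also have "((5 / 4 :: real) ^ n) ^ (2 * m) * ((1 / 2) ^ n) ^ m = ((25 / 32) ^ m) ^ n"
        proof -
          have "((5 / 4 :: real) ^ n) ^ (2 * m) = (((5 / 4)\<^sup>2) ^ n) ^ m"
            by (simp only: mult_ac flip: power_mult)
          also have "(5 / 4 :: real)\<^sup>2 = 25 / 16" by (simp add: power2_eq_square)
          finally have "((5 / 4 :: real) ^ n) ^ (2 * m) = ((25 / 16) ^ n) ^ m" .
          then show ?thesis
            by (simp add: mult.commute[of n] flip: power_mult_distrib power_mult)
        qed
        also have "D * ((25 / 32) ^ m) ^ n * w n j ^ (2 * m)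
            \<le> D * ((25 / 32) ^ m) ^ n * (4 ^ n * (4 / (real j + 1)\<^sup>2))"
          using D0 m unfolding w_def by (intro mult_left_mono kink_weight_bound) auto
        also have "\<dots> = D * r ^ n * (4 / (real j + 1)\<^sup>2)"
          unfolding r_def by (simp only: power_mult_distrib mult_ac)
        finally show "?s ^ (2 * m) * (fact (2 * m) / (2 ^ m * fact m) * (LINT \<omega>|M. (Z n j \<omega>)\<^sup>2) ^ m)
          \<le> D * r ^ n * (4 / (real j + 1)\<^sup>2)" .
      qed
      finally show ?thesis .
    qed
    have "(\<integral>\<^sup>+\<omega>. T (2 * m) \<omega> \<partial>M) = (\<Sum>n. \<Sum>j. \<integral>\<^sup>+\<omega>. ennreal (A n j \<omega> ^ (2 * m)) \<partial>M)"
      unfolding T_def by (simp add: nn_integral_suminf)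
    also have "\<dots> \<le> (\<Sum>n. \<Sum>j. ennreal (D * r ^ n * (4 / (real j + 1)\<^sup>2)))"
      by (intro suminf_le A_mom) auto
    also have "(\<Sum>j. ennreal (D * r ^ n * (4 / (real j + 1)\<^sup>2))) = ennreal (D * r ^ n * W)" for n
      unfolding W_def suminf_mult[OF sw, symmetric]
      using D0 r0 by (intro suminf_ennreal2 summable_mult[OF sw]) simp
    then have "(\<Sum>n. \<Sum>j. ennreal (D * r ^ n * (4 / (real j + 1)\<^sup>2))) = (\<Sum>n. ennreal (D * r ^ n * W))"
      by simp
    also have "\<dots> = ennreal (\<Sum>n. D * r ^ n * W)"
      using D0 r0 r1 W0 by (intro suminf_ennreal2 summable_mult2 summable_mult summable_geometric) auto
    finally show ?thesis by blast
  qed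
  \<comment> \<open>The constant must be the same for all orders \<open>p\<close>, so it is the
    supremum of the weighted kinks and not the root of one \<open>T p\<close>.
    \<open>enn2real\<close> gives the value 0 where the supremum is infinite, which happens on a
    null set.\<close>
  define S where "S \<omega> = (SUP i. ennreal (A (fst i) (snd i) \<omega>))" for \<omega>
  define G where "G \<omega> = enn2real (S \<omega>)" for \<omega>
  have [measurable]: "S \<in> borel_measurable M"
    unfolding S_def by measurable
  have [measurable]: "G \<in> borel_measurable M"
    unfolding G_def by measurable
  have S_le: "S \<omega> \<le> ennreal (root p (enn2real (T p \<omega>)))" if "T p \<omega> < \<infinity>" "p > 0" for p \<omega>
    unfolding S_def
  proof (intro SUP_least ennreal_leI)
    fix i :: "nat \<times> nat"
    have "ennreal (A (fst i) (snd i) \<omega> ^ p) \<le> (\<Sum>j. ennreal (A (fst i) j \<omega> ^ p))"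
      using sum_le_suminf[of "\<lambda>j. ennreal (A (fst i) j \<omega> ^ p)" "{snd i}"] by auto
    also have "\<dots> \<le> T p \<omega>"
      using sum_le_suminf[of "\<lambda>n. \<Sum>j. ennreal (A n j \<omega> ^ p)" "{fst i}"] by (auto simp: T_def)
    also have "\<dots> = ennreal (enn2real (T p \<omega>))" using that by (simp add: less_top)
    finally have "A (fst i) (snd i) \<omega> ^ p \<le> enn2real (T p \<omega>)" by (simp add: ennreal_le_iff)
    then have "root p (A (fst i) (snd i) \<omega> ^ p) \<le> root p (enn2real (T p \<omega>))"
      using that by (intro real_root_le_mono) auto
    then show "A (fst i) (snd i) \<omega> \<le> root p (enn2real (T p \<omega>))"
      using that A0 by (simp add: real_root_power_cancel)
  qed
  \<comment> \<open>This holds at every point: where \<open>T p\<close> is infinite there is nothing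
    to show.\<close>
  have G_le: "ennreal (\<bar>G \<omega>\<bar> ^ p) \<le> T p \<omega>" if "p > 0" for p \<omega>
  proof (cases "T p \<omega> < \<infinity>")
    case True
    let ?t = "enn2real (T p \<omega>)"
    have "G \<omega> \<le> root p ?t"
      using enn2real_mono[OF S_le[OF True that]] that by (simp add: G_def real_root_ge_zero)
    then have "\<bar>G \<omega>\<bar> ^ p \<le> root p ?t ^ p"
      by (intro power_mono) (auto simp: G_def)
    also have "\<dots> = ?t" using that by simp
    finally have "ennreal (\<bar>G \<omega>\<bar> ^ p) \<le> ennreal ?t" by (rule ennreal_leI)
    also have "ennreal ?t = T p \<omega>" using True by (simp add: less_top)
    finally show ?thesis .
  qed (simp add: not_less top_unique)
  show thesis
  proof (rule that[of G])
    show "bounded_moments M (UNIV :: unit set) (\<lambda>_. G)"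
    proof (rule bounded_moments_cofinal[OF assms(1)])
      fix m :: nat
      obtain B :: real where "(\<integral>\<^sup>+\<omega>. T (2 * (m + 6)) \<omega> \<partial>M) \<le> ennreal B"
        using T[of "m + 6"] by auto
      then have "(\<integral>\<^sup>+\<omega>. ennreal (\<bar>G \<omega>\<bar> ^ (2 * (m + 6))) \<partial>M) \<le> ennreal B"
        by (rule order_trans[rotated]) (intro nn_integral_mono G_le, simp)
      then show "\<exists>p\<ge>m. \<exists>B::real. \<forall>i\<in>(UNIV::unit set). (\<integral>\<^sup>+\<omega>. ennreal (\<bar>G \<omega>\<bar> ^ p) \<partial>M) \<le> ennreal B"
        by (intro exI[of _ "2 * (m + 6)"]) auto
    qed simp
    \<comment> \<open>One order with an integrable series makes the supremum finite almost
      everywhere; \<open>2 * 6\<close> is the lowest order treated above.\<close>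
    have "AE \<omega> in M. T (2 * 6) \<omega> \<noteq> \<infinity>"
      using T[of 6] by (intro nn_integral_noteq_infinite) (auto simp: top_unique)
    then show "AE \<omega> in M. kink_bounded (\<lambda>x. V x \<omega>) (G \<omega>)"
    proof (rule eventually_mono)
      fix \<omega> assume "T (2 * 6) \<omega> \<noteq> \<infinity>"
      then have "S \<omega> \<le> ennreal (root (2 * 6) (enn2real (T (2 * 6) \<omega>)))"
        by (intro S_le) (auto simp: less_top)
      then have "S \<omega> < \<top>" by (rule le_less_trans) simp
      then have S: "S \<omega> = ennreal (G \<omega>)"
        unfolding G_def by simp
      have AG: "A n j \<omega> \<le> G \<omega>" for n j
      proof -
        have "ennreal (A n j \<omega>) \<le> S \<omega>" unfolding S_def by (rule SUP_upper2[of "(n, j)"]) auto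
        then show ?thesis unfolding S by (simp add: ennreal_le_iff G_def)
      qed
      show "kink_bounded (\<lambda>x. V x \<omega>) (G \<omega>)"
        unfolding kink_bounded_def
      proof (intro allI)
        fix n k
        have pos: "1 + \<bar>real_of_int k\<bar> / 2 ^ n > 0" by (intro add_pos_nonneg) auto
        have "\<bar>dyadic_kink (\<lambda>x. V x \<omega>) n k\<bar> * ((5 / 4) ^ n * (1 / (1 + \<bar>real_of_int k\<bar> / 2 ^ n))) \<le> G \<omega>"
          using AG[of n "int_encode k"] by (simp add: A_def Z_def w_def)
        then have "\<bar>dyadic_kink (\<lambda>x. V x \<omega>) n k\<bar> * (5 / 4) ^ n \<le> G \<omega> * (1 + \<bar>real_of_int k\<bar> / 2 ^ n)"
          using pos by (simp add: pos_divide_le_eq)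
        then have "\<bar>dyadic_kink (\<lambda>x. V x \<omega>) n k\<bar> * (5 / 4) ^ n * (4 / 5) ^ n
            \<le> G \<omega> * (1 + \<bar>real_of_int k\<bar> / 2 ^ n) * (4 / 5) ^ n"
          by (intro mult_right_mono) auto
        moreover have "(5 / 4 :: real) ^ n * (4 / 5) ^ n = 1"
          by (simp flip: power_mult_distrib)
        ultimately show "\<bar>dyadic_kink (\<lambda>x. V x \<omega>) n k\<bar> \<le> G \<omega> * (4 / 5) ^ n * (1 + \<bar>real_of_int k\<bar> / 2 ^ n)"
          by (simp only: mult.assoc mult_1_right) (simp only: mult_ac)
      qed
    qed
  qed
qed

section \<open>Mean square continuous processes with bounded moments\<close>

definition regular_process ::
  "'a measure \<Rightarrow> 'i::topological_space set \<Rightarrow> ('i \<Rightarrow> 'a \<Rightarrow> real) \<Rightarrow> bool" where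
  "regular_process M S Z \<longleftrightarrow> bounded_moments M S Z \<and> mean_square_continuous_on M S Z"

lemma ennreal_tendsto_0_iff:
  fixes f :: "'b \<Rightarrow> ennreal"
  shows "(f \<longlongrightarrow> 0) F \<longleftrightarrow> (\<forall>e::real>0. \<forall>\<^sub>F x in F. f x \<le> ennreal e)"
proof
  assume "(f \<longlongrightarrow> 0) F"
  then have "\<forall>\<^sub>F x in F. f x < ennreal e" if "e > 0" for e
    using that by (intro order_tendstoD(2)) auto
  then show "\<forall>e::real>0. \<forall>\<^sub>F x in F. f x \<le> ennreal e"
    by (blast intro: eventually_mono less_imp_le)
next
  assume *: "\<forall>e::real>0. \<forall>\<^sub>F x in F. f x \<le> ennreal e"
  show "(f \<longlongrightarrow> 0) F"
  proof (rule order_tendstoI)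
    fix a :: ennreal assume "0 < a"
    then obtain b where "0 < b" "b < a" using dense by blast
    then obtain e :: real where e: "0 < e" "ennreal e < a"
      by (cases b) (auto simp: ennreal_less_zero_iff)
    then have "\<forall>\<^sub>F x in F. f x \<le> ennreal e" using * by blast
    then show "\<forall>\<^sub>F x in F. f x < a" using e(2) by (auto elim!: eventually_mono)
  qed simp
qed

text \<open>The constant \<open>K\<close> may depend on \<open>s\<close> and \<open>e\<close> and
  may blow up as \<open>e\<close> tends to 0, which is all that the estimate for the potential can
  offer. The function \<open>g\<close> carries deterministic coefficients such as the inverse
  mass.\<close>

lemma mean_square_continuous_on_dominated:
  assumes Z: "mean_square_continuous_on M S Z"
    and meas: "\<And>s. s \<in> S \<Longrightarrow> W s \<in> borel_measurable M"
    and g: "continuous_on S (g :: _ \<Rightarrow> real)"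
    and dom: "\<And>s e. s \<in> S \<Longrightarrow> e > 0 \<Longrightarrow> \<exists>K\<ge>0. \<forall>s'\<in>S.
      (\<integral>\<^sup>+\<omega>. ennreal (\<bar>W s' \<omega> - W s \<omega>\<bar>\<^sup>2) \<partial>M)
        \<le> ennreal e + ennreal K * ((\<integral>\<^sup>+\<omega>. ennreal (\<bar>Z s' \<omega> - Z s \<omega>\<bar>\<^sup>2) \<partial>M) + ennreal \<bar>g s' - g s\<bar>)"
  shows "mean_square_continuous_on M S W"
  unfolding mean_square_continuous_on_def
proof (intro conjI ballI)
  fix s assume s: "s \<in> S"
  show "W s \<in> borel_measurable M" by (rule meas[OF s])
  let ?I = "\<lambda>Z s'. \<integral>\<^sup>+\<omega>. ennreal (\<bar>Z s' \<omega> - Z s \<omega>\<bar>\<^sup>2) \<partial>M"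
  show "((\<lambda>s'. ?I W s') \<longlongrightarrow> 0) (at s within S)"
    unfolding ennreal_tendsto_0_iff
  proof (intro allI impI)
    fix e :: real assume e: "e > 0"
    obtain K where K: "K \<ge> 0"
      and le: "\<And>s'. s' \<in> S \<Longrightarrow> ?I W s' \<le> ennreal (e / 2) + ennreal K * (?I Z s' + ennreal \<bar>g s' - g s\<bar>)"
      using dom[OF s, of "e / 2"] e by auto
    \<comment> \<open>Chosen so that \<open>K * (d + d) <= e / 2\<close>; the summand 1 covers
      \<open>K = 0\<close>.\<close>
    define d where "d = e / (4 * (K + 1))"
    have d: "d > 0" using e K by (simp add: d_def)
    have "(?I Z \<longlongrightarrow> 0) (at s within S)"
      using Z s unfolding mean_square_continuous_on_def by blast
    then have "\<forall>\<^sub>F s' in at s within S. ?I Z s' \<le> ennreal d"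
      using d unfolding ennreal_tendsto_0_iff by blast
    moreover have "\<forall>\<^sub>F s' in at s within S. dist (g s') (g s) < d"
      using g s d unfolding continuous_on_def by (blast intro: tendstoD)
    moreover have "\<forall>\<^sub>F s' in at s within S. s' \<in> S"
      by (simp add: eventually_at_filter)
    ultimately show "\<forall>\<^sub>F s' in at s within S. ?I W s' \<le> ennreal e"
    proof eventually_elim
      case (elim s')
      have "?I W s' \<le> ennreal (e / 2) + ennreal K * (?I Z s' + ennreal \<bar>g s' - g s\<bar>)"
        by (rule le[OF elim(3)])
      also have "\<dots> \<le> ennreal (e / 2) + ennreal K * (ennreal d + ennreal d)"
        using elim by (intro add_left_mono mult_left_mono add_mono ennreal_leI) (auto simp: dist_real_def)
      also have "ennreal d + ennreal d = ennreal (d + d)"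
        using d by (subst ennreal_plus) auto
      also have "ennreal (e / 2) + ennreal K * ennreal (d + d) = ennreal (e / 2 + K * (d + d))"
        using d K e by (simp flip: ennreal_mult ennreal_plus)
      also have "\<dots> \<le> ennreal e"
      proof (rule ennreal_leI)
        have "4 * (K + 1) * d = e" using K by (simp add: d_def)
        then show "e / 2 + K * (d + d) \<le> e" using d by (simp add: algebra_simps)
      qed
      finally show ?case .
    qed
  qed
qed

text \<open>The recursion identifies the new processes with its right-hand sides only for
  \<open>s \<in> S\<close> and on \<open>space M\<close>, so they cannot be rewritten as
  functions.\<close>

lemma regular_process_cong:
  assumes "regular_process M S Z" and eq: "\<And>s \<omega>. s \<in> S \<Longrightarrow> \<omega> \<in> space M \<Longrightarrow> Z s \<omega> = W s \<omega>"
  shows "regular_process M S W"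
proof -
  have Z: "bounded_moments M S Z" "mean_square_continuous_on M S Z"
    using assms(1) by (auto simp: regular_process_def)
  have meas: "W s \<in> borel_measurable M" if "s \<in> S" for s
    using bounded_moments_measurable[OF Z(1) that] measurable_cong[of M "Z s" "W s" borel] eq[OF that]
    by blast
  have "bounded_moments M S W"
    by (rule bounded_moments_dominated[OF Z(1) meas]) (auto intro!: AE_I2 simp: eq)
  moreover have "mean_square_continuous_on M S W"
  proof (rule mean_square_continuous_on_dominated[OF Z(2) meas, where g = "\<lambda>_. 0"])
    fix s and e :: real assume s: "s \<in> S" "e > 0"
    have "(\<integral>\<^sup>+\<omega>. ennreal (\<bar>W s' \<omega> - W s \<omega>\<bar>\<^sup>2) \<partial>M) = (\<integral>\<^sup>+\<omega>. ennreal (\<bar>Z s' \<omega> - Z s \<omega>\<bar>\<^sup>2) \<partial>M)"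
      if "s' \<in> S" for s'
      using s that by (intro nn_integral_cong) (simp add: eq)
    then show "\<exists>K\<ge>0. \<forall>s'\<in>S. (\<integral>\<^sup>+\<omega>. ennreal (\<bar>W s' \<omega> - W s \<omega>\<bar>\<^sup>2) \<partial>M)
        \<le> ennreal e + ennreal K * ((\<integral>\<^sup>+\<omega>. ennreal (\<bar>Z s' \<omega> - Z s \<omega>\<bar>\<^sup>2) \<partial>M) + ennreal \<bar>0 - 0\<bar>)"
      by (intro exI[of _ 1]) simp
  qed auto
  ultimately show ?thesis by (simp add: regular_process_def)
qed

text \<open>Two processes vary at the same time, while the domination criterion compares with one;
  hence the limit is taken directly.\<close>

lemma regular_process_add:
  assumes "regular_process M S Z" "regular_process M S W"
  shows "regular_process M S (\<lambda>s \<omega>. Z s \<omega> + W s \<omega>)"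
proof -
  have Z: "bounded_moments M S Z" "mean_square_continuous_on M S Z"
    and W: "bounded_moments M S W" "mean_square_continuous_on M S W"
    using assms by (auto simp: regular_process_def)
  note bm = bounded_moments_add[OF Z(1) W(1)]
  let ?I = "\<lambda>s Z s'. \<integral>\<^sup>+\<omega>. ennreal (\<bar>Z s' \<omega> - Z s \<omega>\<bar>\<^sup>2) \<partial>M"
  have "(?I s (\<lambda>s \<omega>. Z s \<omega> + W s \<omega>) \<longlongrightarrow> 0) (at s within S)" if s: "s \<in> S" for s
    unfolding ennreal_tendsto_0_iff
  proof (intro allI impI)
    fix e :: real assume e: "e > 0"
    have "(?I s Z \<longlongrightarrow> 0) (at s within S)" "(?I s W \<longlongrightarrow> 0) (at s within S)"
      using Z W s unfolding mean_square_continuous_on_def by blast+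
    then have "\<forall>\<^sub>F s' in at s within S. ?I s Z s' \<le> ennreal (e / 4)"
        "\<forall>\<^sub>F s' in at s within S. ?I s W s' \<le> ennreal (e / 4)"
      using e unfolding ennreal_tendsto_0_iff by auto
    moreover have "\<forall>\<^sub>F s' in at s within S. s' \<in> S"
      by (simp add: eventually_at_filter)
    ultimately show "\<forall>\<^sub>F s' in at s within S. ?I s (\<lambda>s \<omega>. Z s \<omega> + W s \<omega>) s' \<le> ennreal e"
    proof eventually_elim
      case (elim s')
      note [measurable] = bounded_moments_measurable[OF Z(1) s] bounded_moments_measurable[OF W(1) s]
        bounded_moments_measurable[OF Z(1) elim(3)] bounded_moments_measurable[OF W(1) elim(3)]
      have le: "((x + y) - (u + v))\<^sup>2 \<le> 2 * (x - u)\<^sup>2 + 2 * (y - v)\<^sup>2" for x y u v :: real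
      proof -
        \<comment> \<open>Parallelogram identity for \<open>x - u\<close> and
          \<open>y - v\<close>.\<close>
        have "((x + y) - (u + v))\<^sup>2 + ((x - u) - (y - v))\<^sup>2 = 2 * (x - u)\<^sup>2 + 2 * (y - v)\<^sup>2"
          by (simp add: power2_eq_square algebra_simps)
        then show ?thesis by (smt (verit) zero_le_power2)
      qed
      have "?I s (\<lambda>s \<omega>. Z s \<omega> + W s \<omega>) s' \<le>
        (\<integral>\<^sup>+\<omega>. 2 * ennreal (\<bar>Z s' \<omega> - Z s \<omega>\<bar>\<^sup>2) + 2 * ennreal (\<bar>W s' \<omega> - W s \<omega>\<bar>\<^sup>2) \<partial>M)"
        by (intro nn_integral_mono) (simp add: le ennreal_leI flip: ennreal_plus ennreal_mult ennreal_numeral)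
      also have "\<dots> = 2 * ?I s Z s' + 2 * ?I s W s'"
        by (simp add: nn_integral_add nn_integral_cmult)
      also have "\<dots> \<le> 2 * ennreal (e / 4) + 2 * ennreal (e / 4)"
        using elim by (intro add_mono mult_left_mono) auto
      also have "\<dots> = ennreal e"
        using e by (simp flip: ennreal_plus ennreal_mult ennreal_numeral)
      finally show ?case .
    qed
  qed
  then have "mean_square_continuous_on M S (\<lambda>s \<omega>. Z s \<omega> + W s \<omega>)"
    unfolding mean_square_continuous_on_def using bounded_moments_measurable[OF bm] by blast
  with bm show ?thesis by (simp add: regular_process_def)
qed

lemma regular_process_scale:
  assumes "prob_space M" and "regular_process M S Z"
    and g: "continuous_on S g" and bound: "\<And>s. s \<in> S \<Longrightarrow> \<bar>g s\<bar> \<le> C"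
  shows "regular_process M S (\<lambda>s \<omega>. g s * Z s \<omega>)"
proof -
  have Z: "bounded_moments M S Z" "mean_square_continuous_on M S Z"
    using assms(2) by (auto simp: regular_process_def)
  have bm: "bounded_moments M S (\<lambda>s \<omega>. g s * Z s \<omega>)"
    using bounded_moments_mult[OF bounded_moments_of_bounded[OF assms(1) bound] Z(1)] .
  have "mean_square_continuous_on M S (\<lambda>s \<omega>. g s * Z s \<omega>)"
  proof (rule mean_square_continuous_on_dominated[OF Z(2) bounded_moments_measurable[OF bm] g])
    fix s and e :: real assume s: "s \<in> S" and e: "e > 0"
    obtain B where B: "B \<ge> 0" "\<And>i. i \<in> S \<Longrightarrow> (\<integral>\<^sup>+\<omega>. ennreal (\<bar>Z i \<omega>\<bar>\<^sup>2) \<partial>M) \<le> ennreal B"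
      using bounded_momentsE[OF Z(1), of 2] by metis
    have C: "C \<ge> 0" using bound[OF s] by simp
    \<comment> \<open>\<open>2 * C\<^sup>2\<close> serves the increment of \<open>Z\<close>, and
      \<open>4 * C * B\<close> the increment of \<open>g\<close>. The latter enters to the first
      power because (g s' - g s)^2 is at most 2 C |g s' - g s|.\<close>
    define K where "K = max (2 * C\<^sup>2) (4 * C * B)"
    have K: "K \<ge> 0" "2 * C\<^sup>2 \<le> K" "4 * C * B \<le> K"
      unfolding K_def by (auto simp: le_max_iff_disj)
    have "(\<integral>\<^sup>+\<omega>. ennreal (\<bar>g s' * Z s' \<omega> - g s * Z s \<omega>\<bar>\<^sup>2) \<partial>M)
        \<le> ennreal K * ((\<integral>\<^sup>+\<omega>. ennreal (\<bar>Z s' \<omega> - Z s \<omega>\<bar>\<^sup>2) \<partial>M) + ennreal \<bar>g s' - g s\<bar>)"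
      if s': "s' \<in> S" for s'
    proof -
      note [measurable] = bounded_moments_measurable[OF Z(1) s] bounded_moments_measurable[OF Z(1) s']
      let ?d = "\<bar>g s' - g s\<bar>"
      have le: "(g s' * x - g s * y)\<^sup>2 \<le> 2 * C\<^sup>2 * (x - y)\<^sup>2 + 4 * C * ?d * y\<^sup>2" for x y :: real
      proof -
        have "(g s' * x - g s * y)\<^sup>2 + (g s' * (x - y) - (g s' - g s) * y)\<^sup>2
            = 2 * ((g s')\<^sup>2 * (x - y)\<^sup>2) + 2 * ((g s' - g s)\<^sup>2 * y\<^sup>2)"
          by (simp add: power2_eq_square algebra_simps)
        moreover have "(g s')\<^sup>2 * (x - y)\<^sup>2 \<le> C\<^sup>2 * (x - y)\<^sup>2"
          using power_mono[OF bound[OF s'], of 2] by (intro mult_right_mono) auto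
        moreover have "(g s' - g s)\<^sup>2 * y\<^sup>2 \<le> (2 * C * ?d) * y\<^sup>2"
        proof (intro mult_right_mono)
          have "?d \<le> 2 * C" using bound[OF s] bound[OF s'] by linarith
          then have "?d * ?d \<le> 2 * C * ?d" by (intro mult_right_mono) auto
          then show "(g s' - g s)\<^sup>2 \<le> 2 * C * ?d" by (simp add: power2_eq_square)
        qed simp
        ultimately show ?thesis
          using zero_le_power2[of "g s' * (x - y) - (g s' - g s) * y"] by linarith
      qed
      have "(\<integral>\<^sup>+\<omega>. ennreal (\<bar>g s' * Z s' \<omega> - g s * Z s \<omega>\<bar>\<^sup>2) \<partial>M)
        \<le> (\<integral>\<^sup>+\<omega>. ennreal (2 * C\<^sup>2) * ennreal (\<bar>Z s' \<omega> - Z s \<omega>\<bar>\<^sup>2)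
            + ennreal (4 * C * ?d) * ennreal (\<bar>Z s \<omega>\<bar>\<^sup>2) \<partial>M)"
        using C by (intro nn_integral_mono) (simp add: le flip: ennreal_plus ennreal_mult)
      also have "\<dots> = ennreal (2 * C\<^sup>2) * (\<integral>\<^sup>+\<omega>. ennreal (\<bar>Z s' \<omega> - Z s \<omega>\<bar>\<^sup>2) \<partial>M)
          + ennreal (4 * C * ?d) * (\<integral>\<^sup>+\<omega>. ennreal (\<bar>Z s \<omega>\<bar>\<^sup>2) \<partial>M)"
        by (simp add: nn_integral_add nn_integral_cmult del: power2_abs)
      also have "\<dots> \<le> ennreal K * (\<integral>\<^sup>+\<omega>. ennreal (\<bar>Z s' \<omega> - Z s \<omega>\<bar>\<^sup>2) \<partial>M) + ennreal K * ennreal ?d"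
      proof (intro add_mono mult_right_mono ennreal_leI K)
        have "ennreal (4 * C * ?d) * (\<integral>\<^sup>+\<omega>. ennreal (\<bar>Z s \<omega>\<bar>\<^sup>2) \<partial>M) \<le> ennreal (4 * C * ?d) * ennreal B"
          by (intro mult_left_mono B s) auto
        also have "\<dots> = ennreal (4 * C * B * ?d)"
          using C B by (simp add: mult_ac flip: ennreal_mult)
        also have "\<dots> \<le> ennreal (K * ?d)" by (intro ennreal_leI mult_right_mono K) auto
        finally show "ennreal (4 * C * ?d) * (\<integral>\<^sup>+\<omega>. ennreal (\<bar>Z s \<omega>\<bar>\<^sup>2) \<partial>M) \<le> ennreal K * ennreal ?d"
          using K by (simp add: ennreal_mult)
      qed simp
      finally show ?thesis by (simp add: distrib_left)
    qed
    then show "\<exists>K\<ge>0. \<forall>s'\<in>S. (\<integral>\<^sup>+\<omega>. ennreal (\<bar>g s' * Z s' \<omega> - g s * Z s \<omega>\<bar>\<^sup>2) \<partial>M)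
        \<le> ennreal e + ennreal K * ((\<integral>\<^sup>+\<omega>. ennreal (\<bar>Z s' \<omega> - Z s \<omega>\<bar>\<^sup>2) \<partial>M) + ennreal \<bar>g s' - g s\<bar>)"
      using K(1) by (intro exI[of _ K]) (auto intro: add_increasing)
  qed
  with bm show ?thesis by (simp add: regular_process_def)
qed

section \<open>Composition with the derivative of the potential\<close>

text \<open>Evaluating the random function at a random point is measurable because at level
  \<open>n\<close> the point enters only through an integer, which takes countably many values; the
  derivative is the limit over \<open>n\<close>.\<close>

lemma measurable_potential_deriv:
  assumes V: "\<And>x. V x \<in> borel_measurable M" and Z: "Z \<in> borel_measurable M"
    and diff: "\<And>\<omega> x. \<omega> \<in> space M \<Longrightarrow> (\<lambda>u. V u \<omega>) differentiable (at x)"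
  shows "(\<lambda>\<omega>. potential_deriv V (Z \<omega>) \<omega>) \<in> borel_measurable M"
proof (rule borel_measurable_LIMSEQ_real)
  fix \<omega> assume "\<omega> \<in> space M"
  then show "(\<lambda>n. dyadic_slope (\<lambda>u. V u \<omega>) n \<lfloor>Z \<omega> * 2 ^ n\<rfloor>) \<longlonglongrightarrow> potential_deriv V (Z \<omega>) \<omega>"
    unfolding potential_deriv_def by (intro dyadic_slope_tendsto_deriv diff)
next
  fix n
  note [measurable] = V Z
  show "(\<lambda>\<omega>. dyadic_slope (\<lambda>u. V u \<omega>) n \<lfloor>Z \<omega> * 2 ^ n\<rfloor>) \<in> borel_measurable M"
  proof (rule measurable_compose_countable)
    show "(\<lambda>\<omega>. dyadic_slope (\<lambda>u. V u \<omega>) n k) \<in> borel_measurable M" for k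
      unfolding dyadic_slope_def by measurable
    show "(\<lambda>\<omega>. \<lfloor>Z \<omega> * 2 ^ n\<rfloor>) \<in> measurable M (count_space UNIV)"
      by measurable
  qed
qed

text \<open>Kinks control only changes of slope, so the slope \<open>V 1 - V 0\<close> of one
  interval is added; it is Gaussian and has all moments. The quantifiers over points stand inside
  the almost sure statement, which permits random points.\<close>

lemma potential_deriv_bounds:
  assumes "prob_space M" and cg: "centered_gaussian_process M UNIV V c" and "C2_lipschitz_mixed c"
    and diff: "\<And>\<omega> x. \<omega> \<in> space M \<Longrightarrow> (\<lambda>u. V u \<omega>) differentiable (at x)"
  obtains Q where "bounded_moments M (UNIV :: unit set) (\<lambda>_. Q)"
    and "AE \<omega> in M. \<forall>x. \<bar>potential_deriv V x \<omega>\<bar> \<le> Q \<omega> * (2 + \<bar>x\<bar>)\<^sup>2"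
    and "AE \<omega> in M. \<forall>n x y. \<bar>x - y\<bar> \<le> 1 / 2 ^ n \<longrightarrow>
      \<bar>potential_deriv V x \<omega> - potential_deriv V y \<omega>\<bar> \<le> Q \<omega> * (2 + \<bar>x\<bar> + \<bar>y\<bar>) * (4 / 5) ^ n"
proof -
  obtain G where G: "bounded_moments M (UNIV :: unit set) (\<lambda>_. G)"
    and kink: "AE \<omega> in M. kink_bounded (\<lambda>x. V x \<omega>) (G \<omega>)"
    using potential_kink_bounded[OF assms(1-3)] by blast
  define A where "A \<omega> = dyadic_slope (\<lambda>u. V u \<omega>) 0 0" for \<omega>
  have A: "A = (\<lambda>\<omega>. \<Sum>i\<in>{0, 1}. (if i = 0 then - 1 else 1) * V i \<omega>)"
    by (auto simp: A_def dyadic_slope_def)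
  have "bounded_moments M (UNIV :: unit set) (\<lambda>_. A)"
    unfolding A
  proof (rule gaussian_bounded_moments[OF assms(1)])
    note sums = centered_gaussian_process_sum[OF assms(1) cg, of "{0, 1}" "\<lambda>i. if i = 0 then - 1 else 1"]
    show "gaussian_rv M (\<lambda>\<omega>. \<Sum>i\<in>{0, 1}. (if i = 0 then - 1 else 1) * V i \<omega>)"
      "(LINT \<omega>|M. (\<Sum>i\<in>{0, 1}. (if i = 0 then - 1 else 1) * V i \<omega>)) = 0"
      by (rule sums; simp)+
  qed (rule order_refl)
  from bounded_moments_add[OF bounded_moments_abs[OF this]
      bounded_moments_mult[OF bounded_moments_const[OF assms(1), of UNIV 14] G]]
  have Q: "bounded_moments M (UNIV :: unit set) (\<lambda>_ \<omega>. \<bar>A \<omega>\<bar> + 14 * G \<omega>)" .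
  show thesis
  proof (rule that[OF Q])
    show "AE \<omega> in M. \<forall>x. \<bar>potential_deriv V x \<omega>\<bar> \<le> (\<bar>A \<omega>\<bar> + 14 * G \<omega>) * (2 + \<bar>x\<bar>)\<^sup>2"
      using kink AE_space
    proof eventually_elim
      case (elim \<omega>)
      then show ?case
        unfolding potential_deriv_def A_def by (blast intro: kink_bounded_deriv_growth diff)
    qed
    show "AE \<omega> in M. \<forall>n x y. \<bar>x - y\<bar> \<le> 1 / 2 ^ n \<longrightarrow>
      \<bar>potential_deriv V x \<omega> - potential_deriv V y \<omega>\<bar> \<le> (\<bar>A \<omega>\<bar> + 14 * G \<omega>) * (2 + \<bar>x\<bar> + \<bar>y\<bar>) * (4 / 5) ^ n"
      using kink AE_space
    proof eventually_elim
      case (elim \<omega>)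
      show ?case
      proof (intro allI impI)
        fix n x y assume xy: "\<bar>x - y\<bar> \<le> 1 / (2::real) ^ n"
        have "\<bar>potential_deriv V x \<omega> - potential_deriv V y \<omega>\<bar> \<le> 5 * G \<omega> * (2 + \<bar>x\<bar> + \<bar>y\<bar>) * (4 / 5) ^ n"
          unfolding potential_deriv_def by (rule kink_bounded_deriv_diff[OF elim(1) diff[OF elim(2)] xy])
        also have "\<dots> \<le> (\<bar>A \<omega>\<bar> + 14 * G \<omega>) * (2 + \<bar>x\<bar> + \<bar>y\<bar>) * (4 / 5) ^ n"
          using kink_bounded_nonneg[OF elim(1)] by (intro mult_right_mono) auto
        finally show "\<bar>potential_deriv V x \<omega> - potential_deriv V y \<omega>\<bar>
          \<le> (\<bar>A \<omega>\<bar> + 14 * G \<omega>) * (2 + \<bar>x\<bar> + \<bar>y\<bar>) * (4 / 5) ^ n" .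
      qed
    qed
  qed
qed

text \<open>The summand with \<open>m\<^sup>2\<close> and \<open>1 / m\<^sup>2\<close> comes from Young's inequality: it leaves \<open>(x - y)\<^sup>2\<close> without a random
  factor, so that mean square continuity applies to it.\<close>

lemma modulus_interpolation:
  fixes v :: "real \<Rightarrow> real"
  assumes growth: "\<And>x. \<bar>v x\<bar> \<le> q * (2 + \<bar>x\<bar>)\<^sup>2"
    and local: "\<And>x y. \<bar>x - y\<bar> \<le> 1 / 2 ^ n \<Longrightarrow> \<bar>v x - v y\<bar> \<le> q * (2 + \<bar>x\<bar> + \<bar>y\<bar>) * r"
    and r: "0 \<le> r" and m: "m > 0"
  defines "\<Phi> \<equiv> \<lambda>x y. 2 * q * (2 + \<bar>x\<bar> + \<bar>y\<bar>)\<^sup>2"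
  shows "(v x - v y)\<^sup>2 \<le> 2 * r\<^sup>2 * (\<Phi> x y)\<^sup>2
    + 2 * 4 ^ n * (m\<^sup>2 * ((\<Phi> x y)\<^sup>2 * (\<bar>x\<bar> + \<bar>y\<bar>))\<^sup>2 + 1 / m\<^sup>2 * (x - y)\<^sup>2)"
proof -
  let ?t = "2 + \<bar>x\<bar> + \<bar>y\<bar>" and ?d = "\<bar>x - y\<bar>" and ?P = "\<Phi> x y"
  have q: "q \<ge> 0" using order_trans[OF abs_ge_zero growth[of 0]] by simp
  have P0: "?P \<ge> 0" using q by (simp add: \<Phi>_def)
  \<comment> \<open>For close points the local modulus gives the term with \<open>r\<close>. For
    distant points growth alone gives \<open>?P\<close>, and there \<open>2 ^ n * ?d\<close> is at
    least 1.\<close>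
  have "\<bar>v x - v y\<bar> \<le> ?P * (r + 2 ^ n * ?d)"
  proof (cases "?d \<le> 1 / 2 ^ n")
    case True
    have "\<bar>v x - v y\<bar> \<le> q * ?t * r" by (rule local[OF True])
    also have "q * ?t * r \<le> ?P * r"
    proof (intro mult_right_mono r)
      have "?t \<le> ?t\<^sup>2" by (intro self_le_power) auto
      then have "q * ?t \<le> q * ?t\<^sup>2" using q by (intro mult_left_mono)
      also have "\<dots> \<le> ?P" using q by (simp add: \<Phi>_def)
      finally show "q * ?t \<le> ?P" .
    qed
    also have "\<dots> \<le> ?P * (r + 2 ^ n * ?d)" using P0 by (intro mult_left_mono) auto
    finally show ?thesis .
  next
    case False
    then have d: "1 \<le> 2 ^ n * ?d" by (simp add: field_simps)
    have "\<bar>v x\<bar> \<le> q * ?t\<^sup>2" "\<bar>v y\<bar> \<le> q * ?t\<^sup>2"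
      by (rule order_trans[OF growth], intro mult_left_mono power_mono q, auto)+
    then have "\<bar>v x - v y\<bar> \<le> ?P * 1" unfolding \<Phi>_def by linarith
    also have "\<dots> \<le> ?P * (r + 2 ^ n * ?d)" using P0 r d by (intro mult_left_mono) auto
    finally show ?thesis .
  qed
  then have "(v x - v y)\<^sup>2 \<le> (?P * (r + 2 ^ n * ?d))\<^sup>2"
    using power_mono[OF _ abs_ge_zero, of "v x - v y" "?P * (r + 2 ^ n * ?d)" 2] by (simp only: power2_abs)
  also have "\<dots> \<le> 2 * r\<^sup>2 * ?P\<^sup>2 + 2 * 4 ^ n * (?P\<^sup>2 * ?d\<^sup>2)"
  proof -
    have "(r + 2 ^ n * ?d)\<^sup>2 + (r - 2 ^ n * ?d)\<^sup>2 = 2 * r\<^sup>2 + 2 * ((2 ^ n)\<^sup>2 * ?d\<^sup>2)"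
      by (simp add: power2_sum power2_diff power_mult_distrib)
    moreover have "((2::real) ^ n)\<^sup>2 = 4 ^ n"
      by (simp add: power2_eq_square flip: power_mult_distrib)
    ultimately have "(r + 2 ^ n * ?d)\<^sup>2 \<le> 2 * r\<^sup>2 + 2 * (4 ^ n * ?d\<^sup>2)"
      using zero_le_power2[of "r - 2 ^ n * ?d"] by (simp only:)
    then have "?P\<^sup>2 * (r + 2 ^ n * ?d)\<^sup>2 \<le> ?P\<^sup>2 * (2 * r\<^sup>2 + 2 * (4 ^ n * ?d\<^sup>2))"
      by (intro mult_left_mono) auto
    also have "\<dots> = 2 * r\<^sup>2 * ?P\<^sup>2 + 2 * 4 ^ n * (?P\<^sup>2 * ?d\<^sup>2)"
      by (simp only: distrib_left mult_ac)
    finally show ?thesis by (simp only: power_mult_distrib)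
  qed
  also have "?P\<^sup>2 * ?d\<^sup>2 \<le> m\<^sup>2 * (?P\<^sup>2 * (\<bar>x\<bar> + \<bar>y\<bar>))\<^sup>2 + 1 / m\<^sup>2 * (x - y)\<^sup>2"
  proof -
    let ?a = "m * (?P\<^sup>2 * ?d)" and ?b = "?d / m"
    have "?a * ?b = ?P\<^sup>2 * ?d\<^sup>2" using m by (simp add: power2_eq_square)
    moreover have "?a * ?b \<le> ?a\<^sup>2 + ?b\<^sup>2"
    proof -
      have "0 \<le> ?a * ?b" using m by simp
      moreover have "a * b \<le> a\<^sup>2 + b\<^sup>2" if "0 \<le> a * b" for a b :: real
        using sum_squares_bound[of a b] that by linarith
      ultimately show ?thesis by blast
    qed
    \<comment> \<open>One copy of the distance is given up for
      \<open>\<bar>x\<bar> + \<bar>y\<bar>\<close>, whose product with \<open>?P\<^sup>2\<close> has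
      bounded moments; the copy in \<open>?b\<close> is kept.\<close>
    moreover have "?a\<^sup>2 \<le> (m * (?P\<^sup>2 * (\<bar>x\<bar> + \<bar>y\<bar>)))\<^sup>2"
      using m by (intro power_mono mult_left_mono) auto
    ultimately show ?thesis by (simp add: power_mult_distrib power_divide)
  qed
  finally show ?thesis by simp
qed

text \<open>The order of choices matters: the level \<open>n\<close> makes the Hoelder error small,
  the Young parameter \<open>m\<close> then makes the \<open>\<Psi>\<close> term small in spite of
  \<open>4 ^ n\<close>, and whatever remains is a constant times the increment of
  \<open>Z\<close>.\<close>

lemma regular_process_potential_deriv:
  assumes "prob_space M" and cg: "centered_gaussian_process M UNIV V c" and "C2_lipschitz_mixed c"
    and diff: "\<And>\<omega> x. \<omega> \<in> space M \<Longrightarrow> (\<lambda>u. V u \<omega>) differentiable (at x)"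
    and reg: "regular_process M S Z"
  shows "regular_process M S (\<lambda>s \<omega>. potential_deriv V (Z s \<omega>) \<omega>)"
proof -
  obtain Q where Q: "bounded_moments M (UNIV :: unit set) (\<lambda>_. Q)"
    and growth: "AE \<omega> in M. \<forall>x. \<bar>potential_deriv V x \<omega>\<bar> \<le> Q \<omega> * (2 + \<bar>x\<bar>)\<^sup>2"
    and local: "AE \<omega> in M. \<forall>n x y. \<bar>x - y\<bar> \<le> 1 / 2 ^ n \<longrightarrow>
      \<bar>potential_deriv V x \<omega> - potential_deriv V y \<omega>\<bar> \<le> Q \<omega> * (2 + \<bar>x\<bar> + \<bar>y\<bar>) * (4 / 5) ^ n"
    using potential_deriv_bounds[OF assms(1-4)] by blast
  have Z: "bounded_moments M S Z" "mean_square_continuous_on M S Z"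
    using reg by (auto simp: regular_process_def)
  have V_meas: "V x \<in> borel_measurable M" for x
    using cg gaussian_process_component[of M UNIV V x]
    by (auto simp: centered_gaussian_process_def gaussian_rv_def)
  define W where "W s \<omega> = potential_deriv V (Z s \<omega>) \<omega>" for s \<omega>
  have meas: "W s \<in> borel_measurable M" if "s \<in> S" for s
    unfolding W_def by (intro measurable_potential_deriv V_meas bounded_moments_measurable[OF Z(1) that] diff)
  note bm_simps = bounded_moments_mult bounded_moments_add bounded_moments_abs
    bounded_moments_const[OF assms(1)]
  have "bounded_moments M S (\<lambda>s \<omega>. Q \<omega> * ((2 + \<bar>Z s \<omega>\<bar>) * (2 + \<bar>Z s \<omega>\<bar>)))"
    by (intro bm_simps Z(1) bounded_moments_reindex[OF Q, of S "\<lambda>_. ()"]) simp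
  then have bm: "bounded_moments M S W"
  proof (rule bounded_moments_dominated[OF _ meas])
    show "AE \<omega> in M. \<bar>W s \<omega>\<bar> \<le> \<bar>Q \<omega> * ((2 + \<bar>Z s \<omega>\<bar>) * (2 + \<bar>Z s \<omega>\<bar>))\<bar>" for s
      using growth unfolding W_def power2_eq_square
      by eventually_elim (blast intro: order_trans[OF _ abs_ge_self])
  qed
  \<comment> \<open>Indexing by pairs makes the moment bounds \<open>B\<close> and \<open>C\<close>
    uniform in both points, so that \<open>n\<close> and \<open>m\<close> do not depend on the
    moving point.\<close>
  define \<Phi> where "\<Phi> p \<omega> = 2 * Q \<omega> * (2 + \<bar>Z (fst p) \<omega>\<bar> + \<bar>Z (snd p) \<omega>\<bar>)\<^sup>2" for p \<omega>
  define \<Psi> where "\<Psi> p \<omega> = (\<Phi> p \<omega>)\<^sup>2 * (\<bar>Z (fst p) \<omega>\<bar> + \<bar>Z (snd p) \<omega>\<bar>)" for p \<omega>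
  have Zp: "bounded_moments M (S \<times> S) (\<lambda>p. Z (fst p))" "bounded_moments M (S \<times> S) (\<lambda>p. Z (snd p))"
    by (rule bounded_moments_reindex[OF Z(1)], auto)+
  have \<Phi>: "bounded_moments M (S \<times> S) \<Phi>"
    unfolding \<Phi>_def power2_eq_square
    by (intro bm_simps Zp bounded_moments_reindex[OF Q, of "S \<times> S" "\<lambda>_. ()"]) simp_all
  have \<Psi>: "bounded_moments M (S \<times> S) \<Psi>"
    unfolding \<Psi>_def power2_eq_square by (intro bm_simps Zp \<Phi>)
  obtain B where B: "B \<ge> 0" "\<And>p. p \<in> S \<times> S \<Longrightarrow> (\<integral>\<^sup>+\<omega>. ennreal (\<bar>\<Phi> p \<omega>\<bar>\<^sup>2) \<partial>M) \<le> ennreal B"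
    using bounded_momentsE[OF \<Phi>, of 2] by metis
  obtain C where C: "C \<ge> 0" "\<And>p. p \<in> S \<times> S \<Longrightarrow> (\<integral>\<^sup>+\<omega>. ennreal (\<bar>\<Psi> p \<omega>\<bar>\<^sup>2) \<partial>M) \<le> ennreal C"
    using bounded_momentsE[OF \<Psi>, of 2] by metis
  have "mean_square_continuous_on M S W"
  proof (rule mean_square_continuous_on_dominated[OF Z(2) meas, where g = "\<lambda>_. 0"])
    fix s and e :: real assume s: "s \<in> S" and e: "e > 0"
    obtain n where n: "2 * ((4 / 5) ^ n)\<^sup>2 * B \<le> e / 2"
    proof -
      obtain n where n: "(16 / 25 :: real) ^ n < e / (4 * (B + 1))"
        using real_arch_pow_inv[of "e / (4 * (B + 1))" "16 / 25"] e B by auto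
      have "((4 / 5 :: real) ^ n)\<^sup>2 = (16 / 25) ^ n"
        by (simp add: power2_eq_square flip: power_mult_distrib)
      moreover have "(16 / 25 :: real) ^ n * (4 * (B + 1)) \<le> e"
        using n B by (simp add: pos_less_divide_eq)
      moreover have "(16 / 25 :: real) ^ n * (4 * B) \<le> (16 / 25) ^ n * (4 * (B + 1))"
        by (intro mult_left_mono) auto
      ultimately have "((4 / 5) ^ n)\<^sup>2 * (4 * B) \<le> e" by (metis order_trans)
      then show thesis by (intro that[of n]) simp
    qed
    \<comment> \<open>Solves 4 * 4^n * (C + 1) * m^2 = e; the summand 1 keeps the quotient defined
      for \<open>C = 0\<close>.\<close>
    define m where "m = sqrt (e / (4 * 4 ^ n * (C + 1)))"
    have m: "m > 0" using e C by (simp add: m_def)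
    have m2: "2 * 4 ^ n * m\<^sup>2 * C \<le> e / 2"
    proof -
      have "m\<^sup>2 = e / (4 * 4 ^ n * (C + 1))" using e C by (simp add: m_def)
      then have "4 * 4 ^ n * (C + 1) * m\<^sup>2 = e" using C by simp
      moreover have "4 * 4 ^ n * C * m\<^sup>2 \<le> 4 * 4 ^ n * (C + 1) * m\<^sup>2"
        by (intro mult_right_mono mult_left_mono) auto
      ultimately have "4 * 4 ^ n * C * m\<^sup>2 \<le> e" by metis
      then show ?thesis by (simp add: mult_ac)
    qed
    define K where "K = 2 * 4 ^ n * (1 / m\<^sup>2)"
    have "(\<integral>\<^sup>+\<omega>. ennreal (\<bar>W s' \<omega> - W s \<omega>\<bar>\<^sup>2) \<partial>M)
        \<le> ennreal e + ennreal K * (\<integral>\<^sup>+\<omega>. ennreal (\<bar>Z s' \<omega> - Z s \<omega>\<bar>\<^sup>2) \<partial>M)" if s': "s' \<in> S" for s'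
    proof -
      let ?p = "(s', s)"
      have p: "?p \<in> S \<times> S" using s s' by simp
      note [measurable] = bounded_moments_measurable[OF \<Phi> p] bounded_moments_measurable[OF \<Psi> p]
        bounded_moments_measurable[OF Z(1) s] bounded_moments_measurable[OF Z(1) s']
      let ?a = "2 * ((4 / 5) ^ n)\<^sup>2" and ?b = "2 * 4 ^ n * m\<^sup>2"
      have "AE \<omega> in M. (W s' \<omega> - W s \<omega>)\<^sup>2 \<le> ?a * (\<Phi> ?p \<omega>)\<^sup>2 + (?b * (\<Psi> ?p \<omega>)\<^sup>2 + K * (Z s' \<omega> - Z s \<omega>)\<^sup>2)"
        using growth local
      proof eventually_elim
        case (elim \<omega>)
        have "(W s' \<omega> - W s \<omega>)\<^sup>2 \<le> ?a * (\<Phi> ?p \<omega>)\<^sup>2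
            + 2 * 4 ^ n * (m\<^sup>2 * (\<Psi> ?p \<omega>)\<^sup>2 + 1 / m\<^sup>2 * (Z s' \<omega> - Z s \<omega>)\<^sup>2)"
          unfolding W_def \<Psi>_def \<Phi>_def fst_conv snd_conv
          by (rule modulus_interpolation[where v = "\<lambda>x. potential_deriv V x \<omega>"]) (use elim m in auto)
        then show ?case by (simp add: K_def algebra_simps)
      qed
      then have "(\<integral>\<^sup>+\<omega>. ennreal (\<bar>W s' \<omega> - W s \<omega>\<bar>\<^sup>2) \<partial>M) \<le>
         (\<integral>\<^sup>+\<omega>. ennreal ?a * ennreal (\<bar>\<Phi> ?p \<omega>\<bar>\<^sup>2) + (ennreal ?b * ennreal (\<bar>\<Psi> ?p \<omega>\<bar>\<^sup>2)
            + ennreal K * ennreal (\<bar>Z s' \<omega> - Z s \<omega>\<bar>\<^sup>2)) \<partial>M)"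
        by (intro nn_integral_mono_AE, elim eventually_mono)
          (simp add: K_def ennreal_leI flip: ennreal_plus ennreal_mult)
      also have "\<dots> = ennreal ?a * (\<integral>\<^sup>+\<omega>. ennreal (\<bar>\<Phi> ?p \<omega>\<bar>\<^sup>2) \<partial>M)
          + (ennreal ?b * (\<integral>\<^sup>+\<omega>. ennreal (\<bar>\<Psi> ?p \<omega>\<bar>\<^sup>2) \<partial>M)
          + ennreal K * (\<integral>\<^sup>+\<omega>. ennreal (\<bar>Z s' \<omega> - Z s \<omega>\<bar>\<^sup>2) \<partial>M))"
        by (simp add: nn_integral_add nn_integral_cmult del: power2_abs)
      also have "\<dots> \<le> ennreal (e / 2) + (ennreal (e / 2)
          + ennreal K * (\<integral>\<^sup>+\<omega>. ennreal (\<bar>Z s' \<omega> - Z s \<omega>\<bar>\<^sup>2) \<partial>M))"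
      proof (intro add_mono order_refl)
        have "ennreal ?a * (\<integral>\<^sup>+\<omega>. ennreal (\<bar>\<Phi> ?p \<omega>\<bar>\<^sup>2) \<partial>M) \<le> ennreal ?a * ennreal B"
          by (intro mult_left_mono B p) simp
        also have "\<dots> \<le> ennreal (e / 2)"
          using n B(1) by (simp add: ennreal_leI flip: ennreal_mult)
        finally show "ennreal ?a * (\<integral>\<^sup>+\<omega>. ennreal (\<bar>\<Phi> ?p \<omega>\<bar>\<^sup>2) \<partial>M) \<le> ennreal (e / 2)" .
        have "ennreal ?b * (\<integral>\<^sup>+\<omega>. ennreal (\<bar>\<Psi> ?p \<omega>\<bar>\<^sup>2) \<partial>M) \<le> ennreal ?b * ennreal C"
          by (intro mult_left_mono C p) simp
        also have "\<dots> \<le> ennreal (e / 2)"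
          using m2 C(1) by (simp add: ennreal_leI flip: ennreal_mult)
        finally show "ennreal ?b * (\<integral>\<^sup>+\<omega>. ennreal (\<bar>\<Psi> ?p \<omega>\<bar>\<^sup>2) \<partial>M) \<le> ennreal (e / 2)" .
      qed
      also have "\<dots> = ennreal (e / 2 + e / 2) + ennreal K * (\<integral>\<^sup>+\<omega>. ennreal (\<bar>Z s' \<omega> - Z s \<omega>\<bar>\<^sup>2) \<partial>M)"
        using e by (subst ennreal_plus) (auto simp: add.assoc)
      finally show ?thesis by simp
    qed
    then show "\<exists>K\<ge>0. \<forall>s'\<in>S. (\<integral>\<^sup>+\<omega>. ennreal (\<bar>W s' \<omega> - W s \<omega>\<bar>\<^sup>2) \<partial>M)
        \<le> ennreal e + ennreal K * ((\<integral>\<^sup>+\<omega>. ennreal (\<bar>Z s' \<omega> - Z s \<omega>\<bar>\<^sup>2) \<partial>M) + ennreal \<bar>0 - 0\<bar>)"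
      by (intro exI[of _ K]) (simp add: K_def)
  qed (auto intro: continuous_on_const)
  with bm show ?thesis unfolding regular_process_def W_def by blast
qed

section \<open>The initial processes and the masses\<close>

text \<open>A partial derivative at a point of the segment is a derivative at 0 of a shifted line;
  after undoing the shift, the mean value inequality applies along the segment. The interval from
  \<open>min 0 d\<close> to \<open>max 0 d\<close> covers both signs of \<open>d\<close>.\<close>

lemma partial_path_bound:
  fixes f :: "real^2 \<Rightarrow> real"
  assumes "\<And>r. min 0 d \<le> r \<Longrightarrow> r \<le> max 0 d \<Longrightarrow>
    \<exists>D. ((\<lambda>q. f (p + r *\<^sub>R axis i 1 + q *\<^sub>R axis i 1)) has_real_derivative D) (at 0) \<and> \<bar>D\<bar> \<le> B"
  shows "\<bar>f (p + d *\<^sub>R axis i 1) - f p\<bar> \<le> B * \<bar>d\<bar>"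
proof -
  let ?I = "{min 0 d..max 0 d}" and ?g = "\<lambda>r. f (p + r *\<^sub>R axis i 1)"
  have "\<exists>D. \<forall>r\<in>?I. (?g has_real_derivative D r) (at r) \<and> \<bar>D r\<bar> \<le> B"
  proof (rule bchoice, rule ballI)
    fix r assume "r \<in> ?I"
    then obtain D where D: "((\<lambda>q. ?g (q + r)) has_real_derivative D) (at 0)" "\<bar>D\<bar> \<le> B"
      using assms[of r] by (auto simp: algebra_simps)
    then have "(?g has_real_derivative D) (at (0 + r))"
      by (subst DERIV_shift)
    with D(2) show "\<exists>D. (?g has_real_derivative D) (at r) \<and> \<bar>D\<bar> \<le> B" by auto
  qed
  then obtain D where D: "\<And>r. r \<in> ?I \<Longrightarrow> (?g has_real_derivative D r) (at r)" "\<And>r. r \<in> ?I \<Longrightarrow> \<bar>D r\<bar> \<le> B"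
    by blast
  have "norm (?g d - ?g 0) \<le> B * norm (d - 0)"
  proof (rule field_differentiable_bound[of ?I ?g D])
    show "(?g has_real_derivative D r) (at r within ?I)" if "r \<in> ?I" for r
      by (rule has_field_derivative_at_within[OF D(1)[OF that]])
    show "norm (D r) \<le> B" if "r \<in> ?I" for r
      using D(2)[OF that] by simp
  qed auto
  then show ?thesis by simp
qed

lemma vec2_path:
  fixes s s' :: "real^2"
  shows "s' = s + (s' $ 1 - s $ 1) *\<^sub>R axis 1 1 + (s' $ 2 - s $ 2) *\<^sub>R axis 2 1"
  by (simp add: vec_eq_iff forall_2 axis_def)

text \<open>Partial derivatives control \<open>f\<close> only along the axes, so \<open>s\<close>
  and \<open>s'\<close> are joined by a path with one leg per coordinate; the two legs give the
  factor 2.\<close>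

lemma partials_bound_in_ball:
  fixes f :: "real^2 \<Rightarrow> real"
  assumes partial: "\<And>p i. p \<in> ball s d \<Longrightarrow> \<exists>D. ((\<lambda>r. f (p + r *\<^sub>R axis i 1)) has_real_derivative D) (at 0) \<and> \<bar>D\<bar> \<le> B"
    and s': "dist s' s < d" and B: "B \<ge> 0"
  shows "\<bar>f s' - f s\<bar> \<le> 2 * B * dist s' s"
proof -
  let ?d1 = "s' $ 1 - s $ 1" and ?d2 = "s' $ 2 - s $ 2"
  define p where "p = s + ?d1 *\<^sub>R axis 1 1"
  have le: "\<bar>?d1\<bar> \<le> dist s' s" "\<bar>?d2\<bar> \<le> dist s' s"
    using component_le_norm_cart[of "s' - s"] by (auto simp: dist_norm)
  have 1: "\<bar>f p - f s\<bar> \<le> B * \<bar>?d1\<bar>"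
    unfolding p_def
  proof (rule partial_path_bound, rule partial)
    fix r assume r: "min 0 ?d1 \<le> r" "r \<le> max 0 ?d1"
    have "dist s (s + r *\<^sub>R axis 1 1) = \<bar>r\<bar>" by (simp add: dist_norm norm_axis_1)
    also have "\<dots> < d" using r le s' by linarith
    finally show "s + r *\<^sub>R axis 1 1 \<in> ball s d" by simp
  qed
  have "\<bar>f (p + ?d2 *\<^sub>R axis 2 1) - f p\<bar> \<le> B * \<bar>?d2\<bar>"
  proof (rule partial_path_bound, rule partial)
    fix r assume r: "min 0 ?d2 \<le> r" "r \<le> max 0 ?d2"
    have "dist s (p + r *\<^sub>R axis 2 1) \<le> dist s' s"
    proof -
      have "\<bar>r\<bar> \<le> \<bar>?d2\<bar>" using r by linarith
      \<comment> \<open>On the second leg every coordinate is at least as close to that of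
        \<open>s\<close> as the coordinate of \<open>s'\<close> is, so the path stays in the
        ball.\<close>
      then have "norm (p + r *\<^sub>R axis 2 1 - s) \<le> norm (s' - s)"
        by (intro norm_le_componentwise_cart) (simp add: p_def axis_def forall_2)
      then show ?thesis by (simp add: dist_norm norm_minus_commute)
    qed
    then show "p + r *\<^sub>R axis 2 1 \<in> ball s d" using s' by simp
  qed
  moreover have "p + ?d2 *\<^sub>R axis 2 1 = s'" unfolding p_def by (rule vec2_path[symmetric])
  ultimately have 2: "\<bar>f s' - f p\<bar> \<le> B * \<bar>?d2\<bar>" by (simp only:)
  have "B * \<bar>?d1\<bar> \<le> B * dist s' s" "B * \<bar>?d2\<bar> \<le> B * dist s' s"
    using le B by (auto intro: mult_left_mono)
  with 1 2 show ?thesis by linarith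
qed

text \<open>\<open>S\<close> and \<open>U\<close> may fail to be convex, so the path argument works
  only in a ball inside \<open>U\<close>. The radius depends on \<open>s\<close>, the constant does
  not.\<close>

lemma initial_covariance_local_lipschitz:
  assumes "initial_covariance S k"
  obtains B where "B \<ge> 0" "\<And>s. s \<in> S \<Longrightarrow> \<forall>\<^sub>F s' in at s within S.
    \<forall>u\<in>S. \<bar>k s' u - k s u\<bar> \<le> B * dist s' s \<and> \<bar>k u s' - k u s\<bar> \<le> B * dist s' s"
proof -
  obtain U B where U: "open U" "S \<subseteq> U" and B: "\<And>s u i. s \<in> U \<Longrightarrow> u \<in> U \<Longrightarrow>
        (\<exists>D. ((\<lambda>r. k (s + r *\<^sub>R axis i 1) u) has_real_derivative D) (at 0) \<and> \<bar>D\<bar> \<le> B) \<and>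
        (\<exists>D. ((\<lambda>r. k s (u + r *\<^sub>R axis i 1)) has_real_derivative D) (at 0) \<and> \<bar>D\<bar> \<le> B)"
    using assms unfolding initial_covariance_def bounded_partials_on_def by blast
  show thesis
  proof (rule that[of "2 * max B 0"])
    fix s assume s: "s \<in> S"
    then obtain d where d: "d > 0" "ball s d \<subseteq> U" using U open_contains_ball by blast
    have "\<forall>\<^sub>F s' in at s within S. dist s' s < d"
      using d(1) unfolding eventually_at by blast
    then show "\<forall>\<^sub>F s' in at s within S. \<forall>u\<in>S. \<bar>k s' u - k s u\<bar> \<le> 2 * max B 0 * dist s' s
        \<and> \<bar>k u s' - k u s\<bar> \<le> 2 * max B 0 * dist s' s"
    proof (eventually_elim, intro ballI conjI)
      fix s' u assume s': "dist s' s < d" and "u \<in> S"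
      then have u: "u \<in> U" using U by blast
      have bd: "\<exists>D. ((\<lambda>r. k (p + r *\<^sub>R axis i 1) u) has_real_derivative D) (at 0) \<and> \<bar>D\<bar> \<le> max B 0"
        "\<exists>D. ((\<lambda>r. k u (p + r *\<^sub>R axis i 1)) has_real_derivative D) (at 0) \<and> \<bar>D\<bar> \<le> max B 0"
        if "p \<in> ball s d" for p i
        using B[of p u i] B[of u p i] u d(2) that by (meson max.coboundedI1 subsetD)+
      show "\<bar>k s' u - k s u\<bar> \<le> 2 * max B 0 * dist s' s"
        by (rule partials_bound_in_ball[where f = "\<lambda>p. k p u", OF _ s']) (use bd(1) in auto)
      show "\<bar>k u s' - k u s\<bar> \<le> 2 * max B 0 * dist s' s"
        by (rule partials_bound_in_ball[where f = "\<lambda>p. k u p", OF _ s']) (use bd(2) in auto)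
    qed
  qed simp
qed

text \<open>The variance of an increment is a sum of two differences of \<open>k\<close> in one
  argument, hence of order \<open>dist s' s\<close>. Continuity of the diagonal on a compact set
  bounds the variances and with them all moments.\<close>

lemma regular_process_initial:
  assumes "prob_space M" and "compact S"
    and cg: "centered_gaussian_process M S Z k" and ic: "initial_covariance S k"
  shows "regular_process M S Z"
proof -
  obtain B where B: "B \<ge> 0" and lip: "\<And>s. s \<in> S \<Longrightarrow> \<forall>\<^sub>F s' in at s within S.
    \<forall>u\<in>S. \<bar>k s' u - k s u\<bar> \<le> B * dist s' s \<and> \<bar>k u s' - k u s\<bar> \<le> B * dist s' s"
    using initial_covariance_local_lipschitz[OF ic] by blast
  have in_S: "\<forall>\<^sub>F s' in at s within S. s' \<in> S" for s
    by (simp add: eventually_at_filter)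
  have g: "gaussian_rv M (Z i)" "(LINT \<omega>|M. Z i \<omega>) = 0" "(LINT \<omega>|M. (Z i \<omega>)\<^sup>2) = k i i" if "i \<in> S" for i
    using centered_gaussian_process_sum[OF assms(1) cg, of "{i}" "\<lambda>_. 1"] that by simp_all
  have dist0: "((\<lambda>s'. C * dist s' s) \<longlongrightarrow> 0) (at s within S)" for C :: real and s
    by (intro tendsto_mult_right_zero) (simp add: tendsto_dist_iff[symmetric])
  have "continuous_on S (\<lambda>s. k s s)"
    unfolding continuous_on_def
  proof
    fix s assume s: "s \<in> S"
    have "((\<lambda>s'. k s' s' - k s s) \<longlongrightarrow> 0) (at s within S)"
    proof (rule Lim_null_comparison[OF _ dist0[of "2 * B" s]])
      show "\<forall>\<^sub>F s' in at s within S. norm (k s' s' - k s s) \<le> 2 * B * dist s' s"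
        using lip[OF s] in_S
      proof eventually_elim
        case (elim s')
        then have "\<bar>k s' s' - k s s'\<bar> \<le> B * dist s' s" "\<bar>k s s' - k s s\<bar> \<le> B * dist s' s"
          using s by auto
        then show ?case by simp
      qed
    qed
    then show "((\<lambda>s. k s s) \<longlongrightarrow> k s s) (at s within S)" by (simp add: LIM_zero_iff)
  qed
  then have "bounded ((\<lambda>s. k s s) ` S)"
    by (intro compact_imp_bounded compact_continuous_image assms(2))
  then obtain C where C: "\<And>s. s \<in> S \<Longrightarrow> \<bar>k s s\<bar> \<le> C" unfolding bounded_iff by auto
  have "bounded_moments M S Z"
  proof (rule gaussian_bounded_moments[OF assms(1) g(1,2)])
    show "(LINT \<omega>|M. (Z i \<omega>)\<^sup>2) \<le> C" if "i \<in> S" for i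
      using C[OF that] by (simp add: g(3)[OF that])
  qed
  moreover have "mean_square_continuous_on M S Z"
    unfolding mean_square_continuous_on_def
  proof (intro conjI ballI)
    fix s assume s: "s \<in> S"
    show "Z s \<in> borel_measurable M" using g(1)[OF s] by (simp add: gaussian_rv_def)
    have "((\<lambda>s'. ennreal (2 * B * dist s' s)) \<longlongrightarrow> ennreal 0) (at s within S)"
      by (intro tendsto_ennrealI dist0)
    then have lim: "((\<lambda>s'. ennreal (2 * B * dist s' s)) \<longlongrightarrow> 0) (at s within S)" by simp
    show "((\<lambda>s'. \<integral>\<^sup>+\<omega>. ennreal (\<bar>Z s' \<omega> - Z s \<omega>\<bar>\<^sup>2) \<partial>M) \<longlongrightarrow> 0) (at s within S)"
    proof (rule tendsto_sandwich[OF _ _ tendsto_const lim])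
      show "\<forall>\<^sub>F s' in at s within S. (\<integral>\<^sup>+\<omega>. ennreal (\<bar>Z s' \<omega> - Z s \<omega>\<bar>\<^sup>2) \<partial>M) \<le> ennreal (2 * B * dist s' s)"
        using lip[OF s] in_S
      proof eventually_elim
        case (elim s')
        show ?case
        proof (cases "s' = s")
          case False
          \<comment> \<open>The two indices have to be distinct, otherwise the set
            \<open>{s, s'}\<close> collapses and the sum is no increment.\<close>
          define a where "a i = (if i = s then - 1 else 1 :: real)" for i
          have sub: "{s, s'} \<subseteq> S" using s elim by auto
          have d: "(\<lambda>\<omega>. Z s' \<omega> - Z s \<omega>) = (\<lambda>\<omega>. \<Sum>i\<in>{s, s'}. a i * Z i \<omega>)"
            using False by (auto simp: a_def)
          note sums = centered_gaussian_process_sum[OF assms(1) cg _ sub, of a, folded d, simplified]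
          have "(\<integral>\<^sup>+\<omega>. ennreal (\<bar>Z s' \<omega> - Z s \<omega>\<bar>\<^sup>2) \<partial>M) = ennreal (LINT \<omega>|M. (Z s' \<omega> - Z s \<omega>)\<^sup>2)"
            using gaussian_rv_nn_moments[OF assms(1) sums(1,2), of 1] by simp
          also have "(LINT \<omega>|M. (Z s' \<omega> - Z s \<omega>)\<^sup>2) = k s' s' - k s s' - (k s' s - k s s)"
            using sums(3) False by (simp add: a_def)
          also have "\<dots> \<le> 2 * B * dist s' s"
          proof -
            have "\<bar>k s' s' - k s s'\<bar> \<le> B * dist s' s" "\<bar>k s' s - k s s\<bar> \<le> B * dist s' s"
              using elim s by auto
            then show ?thesis by linarith
          qed
          finally show ?thesis by (simp add: ennreal_leI)
        qed simp
      qed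
    qed simp
  qed
  ultimately show ?thesis by (simp add: regular_process_def)
qed

section \<open>Lower bound and continuity of the masses\<close>

lemma mass_ge_1:
  assumes "compact S" "s \<in> S"
  shows "1 \<le> mass S s"
proof -
  obtain u where "mass S s = exp ((norm (sq_vec s - sq_vec u))\<^sup>2)"
    using mass_attained[OF assms(1), of s] assms(2) by blast
  then show ?thesis by simp
qed

lemma continuous_on_mass:
  assumes "compact S"
  shows "continuous_on S (mass S)"
proof (cases "S = {}")
  case False
  let ?f = "\<lambda>s u. (norm (sq_vec s - sq_vec u))\<^sup>2"
  define q where "q s = (SUP u\<in>S. ?f s u)" for s
  have q: "\<exists>u\<in>S. q s = ?f s u \<and> (\<forall>w\<in>S. ?f s w \<le> ?f s u)" for s
    using mass_attained[OF assms False, of s] unfolding mass_def q_def by simp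
  have cont_sq: "continuous_on A sq_vec" for A
    unfolding sq_vec_def by (intro continuous_intros)
  have "bounded (sq_vec ` S)"
    by (intro compact_imp_bounded compact_continuous_image assms cont_sq)
  then obtain R where R: "\<And>s. s \<in> S \<Longrightarrow> norm (sq_vec s) \<le> R" unfolding bounded_iff by auto
  \<comment> \<open>The maximiser for \<open>s'\<close> is a competitor for \<open>s\<close>, which
    gives one inequality; exchanging the points gives the other. The bound \<open>4 * R\<close>
    comes from two distances of at most \<open>2 * R\<close> each.\<close>
  have half: "q s' - q s \<le> 4 * R * dist (sq_vec s') (sq_vec s)" if "s \<in> S" "s' \<in> S" for s s'
  proof -
    obtain u where u: "u \<in> S" "q s' = ?f s' u" using q by blast
    let ?a = "norm (sq_vec s' - sq_vec u)" and ?b = "norm (sq_vec s - sq_vec u)"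
    have "?f s u \<le> q s" using q[of s] u(1) by auto
    then have "q s' - q s \<le> ?a\<^sup>2 - ?b\<^sup>2" using u by simp
    also have "\<dots> = (?a - ?b) * (?a + ?b)" by (simp add: power2_eq_square algebra_simps)
    also have "\<dots> \<le> dist (sq_vec s') (sq_vec s) * (4 * R)"
    proof (rule mult_mono)
      show "?a - ?b \<le> dist (sq_vec s') (sq_vec s)"
        using norm_triangle_ineq2[of "sq_vec s' - sq_vec u" "sq_vec s - sq_vec u"] by (simp add: dist_norm)
      show "?a + ?b \<le> 4 * R"
        using norm_triangle_ineq4[of "sq_vec s'" "sq_vec u"] norm_triangle_ineq4[of "sq_vec s" "sq_vec u"]
          R[OF that(1)] R[OF that(2)] R[OF u(1)] by linarith
    qed auto
    finally show ?thesis by (simp add: mult_ac)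
  qed
  have "continuous_on S q"
    unfolding continuous_on_def
  proof
    fix s assume s: "s \<in> S"
    have "((\<lambda>s'. q s' - q s) \<longlongrightarrow> 0) (at s within S)"
    proof (rule Lim_null_comparison)
      have "((\<lambda>s'. dist (sq_vec s') (sq_vec s)) \<longlongrightarrow> 0) (at s within S)"
        using cont_sq[of S] s unfolding continuous_on_def tendsto_dist_iff[symmetric] by blast
      then show "((\<lambda>s'. 4 * R * dist (sq_vec s') (sq_vec s)) \<longlongrightarrow> 0) (at s within S)"
        by (rule tendsto_mult_right_zero)
      have "\<forall>\<^sub>F s' in at s within S. s' \<in> S" by (simp add: eventually_at_filter)
      then show "\<forall>\<^sub>F s' in at s within S. norm (q s' - q s) \<le> 4 * R * dist (sq_vec s') (sq_vec s)"
      proof eventually_elim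
        case (elim s')
        then show ?case using half[OF s elim] half[OF elim s] by (simp add: dist_commute)
      qed
    qed
    then show "(q \<longlongrightarrow> q s) (at s within S)" by (simp add: LIM_zero_iff)
  qed
  then show ?thesis unfolding mass_def q_def by (intro continuous_on_exp)
qed simp

section \<open>The induction over the time steps\<close>

theorem theorem2p3:
  fixes M :: "'a measure"
    and S :: "(real^2) set"
    and X Y :: "real^2 \<Rightarrow> real \<Rightarrow> 'a \<Rightarrow> real"
    and V :: "real \<Rightarrow> 'a \<Rightarrow> real"
    and kX kY :: "real^2 \<Rightarrow> real^2 \<Rightarrow> real"
    and c :: "real \<Rightarrow> real \<Rightarrow> real"
    and dt \<alpha> \<beta> :: real
  assumes "prob_space M"
    and "compact S"
    and "\<exists>a b. (\<forall>i. a $ i < b $ i) \<and> cbox a b \<subseteq> S"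
    and "centered_gaussian_process M S (\<lambda>s. X s 0) kX" and "initial_covariance S kX"
    and "centered_gaussian_process M S (\<lambda>s. Y s 0) kY" and "initial_covariance S kY"
    and "centered_gaussian_process M UNIV V c" and "C2_lipschitz_mixed c"
    and "\<forall>\<omega>\<in>space M. \<forall>x. (\<lambda>u. V u \<omega>) differentiable (at x)"
    and "dt > 0" and "\<bar>\<alpha>\<bar> < 1" and "\<bar>\<beta>\<bar> < 1"
    and "hamiltonian_dynamics M S dt \<alpha> \<beta> V X Y"
  shows "\<forall>h::nat. h \<ge> 1 \<longrightarrow>
           mean_square_continuous_on M S (\<lambda>s. Y s (real h * dt)) \<and>
           mean_square_continuous_on M S (\<lambda>s. X s (real h * dt))"
proof -
  have diff: "\<And>\<omega> x. \<omega> \<in> space M \<Longrightarrow> (\<lambda>u. V u \<omega>) differentiable (at x)"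
    using assms(10) by blast
  have m1: "1 \<le> mass S s" if "s \<in> S" for s by (rule mass_ge_1[OF assms(2) that])
  \<comment> \<open>As masses are at least 1, division by them is multiplication by a bounded
    continuous function.\<close>
  have scale: "regular_process M S (\<lambda>s \<omega>. C / mass S s * Z s \<omega>)" if "regular_process M S Z" for C Z
  proof (rule regular_process_scale[OF assms(1) that])
    show "continuous_on S (\<lambda>s. C / mass S s)"
      using m1 by (intro continuous_intros continuous_on_mass assms(2)) force
    show "\<bar>C / mass S s\<bar> \<le> \<bar>C\<bar>" if "s \<in> S" for s
      using m1[OF that] mult_left_mono[OF m1[OF that], of "\<bar>C\<bar>"] by (simp add: divide_le_eq)
  qed
  have const: "regular_process M S (\<lambda>s \<omega>. C * Z s \<omega>)" if "regular_process M S Z" for C Z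
    by (rule regular_process_scale[OF assms(1) that continuous_on_const order_refl])
  note force = regular_process_potential_deriv[OF assms(1,8,9) diff]
  have "regular_process M S (\<lambda>s. Y s (real h * dt)) \<and> regular_process M S (\<lambda>s. X s (real h * dt))" for h
  proof (induction h)
    case 0
    then show ?case
      using regular_process_initial[OF assms(1,2,4,5)] regular_process_initial[OF assms(1,2,6,7)] by simp
  next
    case (Suc h)
    let ?t = "real h * dt" and ?F = "potential_deriv V"
    have t: "real (Suc h) * dt = ?t + dt" by (simp add: algebra_simps)
    have Y: "Y s (?t + dt) \<omega> = \<beta> * Y s ?t \<omega> + dt / mass S s * (\<alpha> * X s ?t \<omega> - dt / 2 * ?F (Y s ?t \<omega>) \<omega>)"
      and X: "X s (?t + dt) \<omega> = \<alpha>\<^sup>2 * X s ?t \<omega> - dt / 2 * (\<alpha> * ?F (Y s ?t \<omega>) \<omega> + ?F (Y s (?t + dt) \<omega>) \<omega>)"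
      if "s \<in> S" "\<omega> \<in> space M" for s \<omega>
      using assms(14) that unfolding hamiltonian_dynamics_def Let_def by blast+
    \<comment> \<open>The new position comes before the new momentum, whose update contains the
      force at the new position. Differences are written as sums with a negative factor to fit
      closure under sums and scaling.\<close>
    have reg_Y: "regular_process M S (\<lambda>s. Y s (?t + dt))"
    proof (rule regular_process_cong)
      show "regular_process M S (\<lambda>s \<omega>. \<beta> * Y s ?t \<omega>
          + (dt / mass S s * (\<alpha> * X s ?t \<omega> + - (dt / 2) * ?F (Y s ?t \<omega>) \<omega>)))"
        using Suc by (intro regular_process_add const scale force) auto
    qed (simp add: Y)
    have "regular_process M S (\<lambda>s. X s (?t + dt))"
    proof (rule regular_process_cong)
      show "regular_process M S (\<lambda>s \<omega>. \<alpha>\<^sup>2 * X s ?t \<omega>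
          + - (dt / 2) * (\<alpha> * ?F (Y s ?t \<omega>) \<omega> + ?F (Y s (?t + dt) \<omega>) \<omega>))"
        using Suc reg_Y by (intro regular_process_add const force) auto
    qed (simp add: X)
    with reg_Y show ?case by (simp only: t)
  qed
  then show ?thesis unfolding regular_process_def by blast
qed

end
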